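(* Let $m\geq 1$ be an integer. For $R\in(0,+\infty)$ let $\eta_{(m)}=\eta_{(m)}(R)$ be the $m$th eigenvalue (without counting multiplicity, numbering starting from $m=0$) of the second fourth-order Steklov problem on the closed geodesic disk of radius $R$ in the $2$-dimensional hyperbolic space $\mathbb{H}^2$. Then, as functions of $R$: (1) when $m=1$, $\eta_{(m)}R$ is strictly increasing on $(0,+\infty)$; while for $m\geq 2$ there exists a positive constant $R_m$, depending only on $m$, such that $\eta_{(m)}R$ is strictly decreasing on $(0,R_m)$ and strictly increasing on $(R_m,+\infty)$; (2) $\eta_{(m)}\sinh R$ is strictly increasing on $(0,+\infty)$; (3) $\eta_{(m)}\tanh(R/2)$ is strictly decreasing on $(0,+\infty)$; (4) when $m\leq 2$, $\eta_{(m)}\sinh(R/2)$ is strictly increasing on $(0,+\infty)$; while for $m\geq 3$ there exists a positive constant $\bar R_m$, depending only on $m$, such that $\eta_{(m)}\sinh(R/2)$ is strictly decreasing on $(0,\bar R_m)$ and strictly increasing on $(\bar R_m,+\infty)$.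
   Context: The hyperbolic space $\mathbb{H}^2$ has constant curvature $-1$; the geodesic disk of radius $R$ carries the metric $dr^2+\sinh^2 r\, g_{\mathbb{S}^1}$, $0\le r\le R$, where $r$ is the distance to the center. Second fourth-order Steklov problem: on a smooth compact Riemannian manifold $M$ with boundary $\partial M$ and outward unit normal $\nu$, a real number $\eta$ is an eigenvalue if there is a nontrivial $u$ with $$\Delta^2 u=0 \text{ in } M,\qquad u=0,\quad \Delta u=\eta\frac{\partial u}{\partial\nu} \text{ on } \partial M,$$ where $\Delta$ is the Laplace--Beltrami operator ($\Delta=\operatorname{div}\nabla$). The spectrum is discrete, positive and unbounded; the distinct eigenvalues (without counting multiplicity) are listed in increasing order as $0<\eta_{(0)}<\eta_{(1)}<\eta_{(2)}<\cdots$. *)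

theory Defs
  imports "HOL-Analysis.Analysis"
begin

definition partial_deriv :: "'n \<Rightarrow> (real ^ 'n \<Rightarrow> real) \<Rightarrow> real ^ 'n \<Rightarrow> real" where
  "partial_deriv i f x = frechet_derivative f (at x) (axis i 1)"

text \<open>Continuous differentiability of order k and smoothness, meant for open sets U.\<close>

primrec Ck_on :: "nat \<Rightarrow> (real ^ 'n) set \<Rightarrow> (real ^ 'n \<Rightarrow> real) \<Rightarrow> bool" where
  "Ck_on 0 U f \<longleftrightarrow> continuous_on U f"
| "Ck_on (Suc k) U f \<longleftrightarrow>
     (\<forall>x\<in>U. f differentiable (at x)) \<and> (\<forall>i. Ck_on k U (partial_deriv i f))"

definition smooth_on :: "(real ^ 'n) set \<Rightarrow> (real ^ 'n \<Rightarrow> real) \<Rightarrow> bool" where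
  "smooth_on U f \<longleftrightarrow> (\<forall>k. Ck_on k U f)"

text \<open>Gradient, divergence and Laplace--Beltrami operator, in coordinates, of a Riemannian
  metric given by its matrix field g.\<close>

definition grad :: "(real ^ 'n \<Rightarrow> real ^ 'n ^ 'n) \<Rightarrow> (real ^ 'n \<Rightarrow> real) \<Rightarrow> real ^ 'n \<Rightarrow> real ^ 'n" where
  "grad g f x = matrix_inv (g x) *v (\<chi> i. partial_deriv i f x)"

definition divergence ::
    "(real ^ 'n \<Rightarrow> real ^ 'n ^ 'n) \<Rightarrow> (real ^ 'n \<Rightarrow> real ^ 'n) \<Rightarrow> real ^ 'n \<Rightarrow> real" where
  "divergence g X x =
     (\<Sum>i\<in>UNIV. partial_deriv i (\<lambda>y. sqrt (det (g y)) * X y $ i) x) / sqrt (det (g x))"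

definition laplace_beltrami ::
    "(real ^ 'n \<Rightarrow> real ^ 'n ^ 'n) \<Rightarrow> (real ^ 'n \<Rightarrow> real) \<Rightarrow> real ^ 'n \<Rightarrow> real" where
  "laplace_beltrami g f = divergence g (grad g f)"

text \<open>The hyperbolic plane in geodesic normal coordinates: a point at distance r from the
  center, in direction e, is represented by the vector r e, so that the closed geodesic
  disk of radius R is the set cball 0 R.  Away from the center the metric is
  dr^2 + (sinh r)^2 dtheta^2, written with the component vectors of the covectors dr and dtheta;
  it extends smoothly to the center by the Euclidean metric.\<close>

definition dr :: "real ^ 2 \<Rightarrow> real ^ 2" where
  "dr x = x /\<^sub>R norm x"

definition dtheta :: "real ^ 2 \<Rightarrow> real ^ 2" where
  "dtheta x = vector [- x $ 2, x $ 1] /\<^sub>R (norm x)\<^sup>2"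

definition hyperbolic_metric :: "real ^ 2 \<Rightarrow> real ^ 2 ^ 2" where
  "hyperbolic_metric x =
     (if x = 0 then mat 1
      else \<chi> i j. dr x $ i * dr x $ j + (sinh (norm x))\<^sup>2 * (dtheta x $ i * dtheta x $ j))"

abbreviation hyp_laplacian :: "(real ^ 2 \<Rightarrow> real) \<Rightarrow> real ^ 2 \<Rightarrow> real" where
  "hyp_laplacian \<equiv> laplace_beltrami hyperbolic_metric"

text \<open>The outward unit normal of a disk around the center is the radial coordinate field; the
  two lemmas confirm that it has unit length and is orthogonal to the tangent vectors of the
  boundary circle.\<close>

definition outward_normal :: "real ^ 2 \<Rightarrow> real ^ 2" where
  "outward_normal x = x /\<^sub>R norm x"

lemma outward_normal_unit:
  assumes "x \<noteq> 0"
  shows "outward_normal x \<bullet> (hyperbolic_metric x *v outward_normal x) = 1"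
proof -
  have n: "x $ 1 * x $ 1 + x $ 2 * x $ 2 = norm x * norm x"
    using dot_square_norm[of x] by (simp add: inner_vec_def sum_2 power2_eq_square)
  have "hyperbolic_metric x *v outward_normal x = outward_normal x"
    using assms n
    by (simp add: vec_eq_iff forall_2 matrix_vector_mult_def sum_2 hyperbolic_metric_def
        outward_normal_def dr_def dtheta_def vector_2 field_simps) algebra
  then show ?thesis
    using assms by (simp add: outward_normal_def dot_square_norm power2_eq_square)
qed

lemma outward_normal_orthogonal:
  assumes "x \<noteq> 0" "\<tau> \<bullet> x = 0"
  shows "\<tau> \<bullet> (hyperbolic_metric x *v outward_normal x) = 0"
proof -
  have n: "x $ 1 * x $ 1 + x $ 2 * x $ 2 = norm x * norm x"
    using dot_square_norm[of x] by (simp add: inner_vec_def sum_2 power2_eq_square)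
  have "hyperbolic_metric x *v outward_normal x = outward_normal x"
    using assms(1) n
    by (simp add: vec_eq_iff forall_2 matrix_vector_mult_def sum_2 hyperbolic_metric_def
        outward_normal_def dr_def dtheta_def vector_2 field_simps) algebra
  then show ?thesis
    using assms by (simp add: outward_normal_def)
qed

text \<open>Smoothness up to the boundary means smoothness of an extension to an open neighbourhood of
  the closed disk.\<close>

definition steklov2_eigenvalue :: "real \<Rightarrow> real \<Rightarrow> bool" where
  "steklov2_eigenvalue R \<eta> \<longleftrightarrow>
     (\<exists>U u. open U \<and> cball 0 R \<subseteq> U \<and> smooth_on U u \<and>
        (\<exists>x\<in>cball 0 R. u x \<noteq> 0) \<and>
        (\<forall>x\<in>ball 0 R. hyp_laplacian (hyp_laplacian u) x = 0) \<and>
        (\<forall>x\<in>sphere 0 R. u x = 0 \<and>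
           hyp_laplacian u x = \<eta> * frechet_derivative u (at x) (outward_normal x)))"

text \<open>The distinct eigenvalues in increasing order: the value at m is the m-th smallest one.\<close>

primrec steklov2_eta :: "nat \<Rightarrow> real \<Rightarrow> real" where
  "steklov2_eta 0 R = (LEAST \<eta>. steklov2_eigenvalue R \<eta>)"
| "steklov2_eta (Suc m) R = (LEAST \<eta>. steklov2_eigenvalue R \<eta> \<and> steklov2_eta m R < \<eta>)"

end

(* Write T = tanh (r/2). In polar coordinates sinh^2 r times the Laplacian is
   (sinh r d/dr)^2 + (d/dtheta)^2, so the harmonic functions are spanned by T^m cos (m theta + d).
   Solving Laplacian u = T^m cos (m theta) with u = 0 for r = R gives the eigenvalue
   eta_m = sinh R T(R)^(2m) / F_m(R), where F_m(R) is the integral of T^(2m) sinh r over [0,R].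
   Conversely, taking Fourier coefficients of an arbitrary eigenfunction on circles leads to
   ordinary differential equations that allow no other eigenvalue, by completeness of the
   trigonometric system. Finally eta_m w is a quotient H / F_m, where H and F_m vanish at 0,
   and rho = H' / F_m' = w' + w (cosh R + 2 m) / sinh R is explicit for the four weights w. *)
theory Submission
  imports Defs "HOL-Real_Asymp.Real_Asymp"
begin

section \<open>Differential calculus of smooth functions\<close>

text \<open>The eigenvalue problem is posed for functions smooth through the center, where polar
  coordinates break down. So all coefficients are power series in the squared norm, and the polar
  form of the Laplacian appears multiplied by sinh^2 r, which keeps it valid at the center. Write B
  for sinh r d/dr. As B T = T, on functions of X = T^2 it is 2 X d/dX, and the radial factor of the
  solution becomes an explicit power series in X, visibly smooth at the center. For uniqueness, B^2
  - m^2 = (B + m)(B - m) has the integrating factor T^m, and B f vanishes at the center for every f,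
  which removes the singular solutions. The valleys in the theorem come from the sign of rho': for w
  = R its numerator vanishes at 0 and has the derivative 2 sinh R (sinh R - m R), positive for all R
  > 0 only if m is at most 1; for w = sinh (R/2) the sign is that of 3 cosh^2 (R/2) - (2 m - 1),
  positive for all R > 0 only if m is at most 2.\<close>

lemma partial_deriv_eq:
  "(f has_derivative f') (at x) \<Longrightarrow> partial_deriv i f x = f' (axis i 1)"
  by (metis frechet_derivative_at partial_deriv_def)

lemma partial_deriv_const [simp]: "partial_deriv i (\<lambda>x. c) x = 0"
  by (rule partial_deriv_eq[where f' = "\<lambda>_. 0", simplified]) simp

lemma partial_deriv_component:
  fixes x :: "real ^ 'n"
  shows "partial_deriv i (\<lambda>x. x $ j) x = (if i = j then 1 else 0)"
proof -
  have "((\<lambda>x::real^'n. x $ j) has_derivative (\<lambda>x. x $ j)) (at x)" for x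
    by (rule bounded_linear.has_derivative[OF bounded_linear_vec_nth]) simp
  from partial_deriv_eq[OF this[of x]] show ?thesis
    by (simp add: axis_def)
qed

lemma differentiable_component [simp]: "(\<lambda>x::real^'n. x $ j) differentiable (at x)"
  using bounded_linear_imp_differentiable bounded_linear_vec_nth by blast

lemma partial_deriv_add:
  assumes "f differentiable (at x)" "g differentiable (at x)"
  shows "partial_deriv i (\<lambda>x. f x + g x) x = partial_deriv i f x + partial_deriv i g x"
proof -
  obtain f' g' where *: "(f has_derivative f') (at x)" "(g has_derivative g') (at x)"
    using assms by (auto simp: differentiable_def)
  show ?thesis
    using partial_deriv_eq[OF has_derivative_add[OF *]] *[THEN partial_deriv_eq] by simp
qed

lemma partial_deriv_diff:
  assumes "f differentiable (at x)" "g differentiable (at x)"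
  shows "partial_deriv i (\<lambda>x. f x - g x) x = partial_deriv i f x - partial_deriv i g x"
proof -
  obtain f' g' where *: "(f has_derivative f') (at x)" "(g has_derivative g') (at x)"
    using assms by (auto simp: differentiable_def)
  show ?thesis
    using partial_deriv_eq[OF has_derivative_diff[OF *]] *[THEN partial_deriv_eq] by simp
qed

lemma partial_deriv_mult:
  assumes "f differentiable (at x)" "g differentiable (at x)"
  shows "partial_deriv i (\<lambda>x. f x * g x) x = f x * partial_deriv i g x + partial_deriv i f x * g x"
proof -
  obtain f' g' where *: "(f has_derivative f') (at x)" "(g has_derivative g') (at x)"
    using assms by (auto simp: differentiable_def)
  show ?thesis
    using partial_deriv_eq[OF has_derivative_mult[OF *]] *[THEN partial_deriv_eq] by simp
qed

lemma compose_has_derivative: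
  assumes "(\<phi> has_real_derivative D) (at (f x))" "f differentiable (at x)"
  shows "((\<lambda>x. \<phi> (f x)) has_derivative (\<lambda>h. D * frechet_derivative f (at x) h)) (at x)"
  using has_derivative_compose[OF frechet_derivative_works[THEN iffD1, OF assms(2)]
      assms(1)[unfolded has_field_derivative_def]]
  by (simp add: o_def)

lemma partial_deriv_compose:
  assumes "(\<phi> has_real_derivative D) (at (f x))" "f differentiable (at x)"
  shows "partial_deriv i (\<lambda>x. \<phi> (f x)) x = D * partial_deriv i f x"
  using partial_deriv_eq[OF compose_has_derivative[of \<phi> D f x, OF assms]]
  by (simp add: partial_deriv_def)

lemma frechet_derivative_cong_open:
  assumes "open U" "x \<in> U" "\<And>y. y \<in> U \<Longrightarrow> f y = g y"
  shows "frechet_derivative f (at x) = frechet_derivative g (at x)"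
proof -
  have "(f has_derivative f') (at x) \<longleftrightarrow> (g has_derivative f') (at x)" for f'
    using has_derivative_transform_within_open[OF _ assms(1,2)] assms(3) by metis
  then show ?thesis
    by (simp add: frechet_derivative_def)
qed

lemma partial_deriv_cong_open:
  assumes "open U" "x \<in> U" "\<And>y. y \<in> U \<Longrightarrow> f y = g y"
  shows "partial_deriv i f x = partial_deriv i g x"
  using frechet_derivative_cong_open[OF assms] by (simp add: partial_deriv_def)

lemma differentiable_cong_open:
  assumes "open U" "x \<in> U" "\<And>y. y \<in> U \<Longrightarrow> f y = g y" "f differentiable (at x)"
  shows "g differentiable (at x)"
  using has_derivative_transform_within_open[OF _ assms(1,2)] assms(3,4)
  unfolding differentiable_def by metis

lemma Ck_on_cong:
  assumes "open U" "\<And>y. y \<in> U \<Longrightarrow> f y = g y" "Ck_on k U f"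
  shows "Ck_on k U g"
  using assms(2,3)
proof (induction k arbitrary: f g)
  case 0
  then show ?case using continuous_on_cong by fastforce
next
  case (Suc k)
  have "Ck_on k U (partial_deriv i g)" for i
    using Suc.IH[of "partial_deriv i f" "partial_deriv i g"] Suc.prems
      partial_deriv_cong_open[OF assms(1), of _ f g] by simp
  moreover have "g differentiable (at x)" if "x \<in> U" for x
    using differentiable_cong_open[OF assms(1) that, of f g] Suc.prems that by simp
  ultimately show ?case by simp
qed

lemma Ck_on_continuous: "Ck_on k U f \<Longrightarrow> continuous_on U f"
  by (cases k) (auto intro!: differentiable_imp_continuous_on simp: differentiable_on_def
      differentiable_at_withinI)

lemma Ck_on_SucD: "Ck_on (Suc k) U f \<Longrightarrow> Ck_on k U f"
proof (induction k arbitrary: f)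
  case 0
  then show ?case using Ck_on_continuous Ck_on.simps(1) by blast
next
  case (Suc k)
  then show ?case by (metis Ck_on.simps(2))
qed

lemma Ck_on_const:
  fixes U :: "(real ^ 'n) set"
  shows "Ck_on k U (\<lambda>x. c)"
proof (induction k arbitrary: c)
  case (Suc k)
  have "partial_deriv i (\<lambda>x::real^'n. c) = (\<lambda>x. 0)" for i by (auto simp: fun_eq_iff)
  then show ?case using Suc by simp
qed (simp)

lemma Ck_on_component:
  fixes U :: "(real ^ 'n) set"
  shows "Ck_on k U (\<lambda>x. x $ j)"
proof (cases k)
  case (Suc l)
  have "partial_deriv i (\<lambda>x::real^'n. x $ j) = (\<lambda>x. if i = j then 1 else 0)" for i
    by (auto simp: fun_eq_iff partial_deriv_component)
  then show ?thesis using Suc Ck_on_const[of l U] by simp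
qed (auto intro!: continuous_intros)

lemma Ck_on_add:
  assumes "open U"
  shows "Ck_on k U f \<Longrightarrow> Ck_on k U g \<Longrightarrow> Ck_on k U (\<lambda>x. f x + g x)"
proof (induction k arbitrary: f g)
  case (Suc k)
  have "Ck_on k U (partial_deriv i (\<lambda>x. f x + g x))" for i
    by (rule Ck_on_cong[OF assms, of "\<lambda>x. partial_deriv i f x + partial_deriv i g x"])
       (use Suc in \<open>auto simp: partial_deriv_add\<close>)
  then show ?case using Suc.prems by simp
qed (auto intro!: continuous_intros)

lemma Ck_on_mult:
  assumes "open U"
  shows "Ck_on k U f \<Longrightarrow> Ck_on k U g \<Longrightarrow> Ck_on k U (\<lambda>x. f x * g x)"
proof (induction k arbitrary: f g)
  case (Suc k)
  have "Ck_on k U (partial_deriv i (\<lambda>x. f x * g x))" for i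
    by (rule Ck_on_cong[OF assms, of "\<lambda>x. f x * partial_deriv i g x + partial_deriv i f x * g x"])
       (use Suc.prems Suc.prems[THEN Ck_on_SucD] Suc.IH in
         \<open>auto simp: partial_deriv_mult intro!: Ck_on_add[OF assms]\<close>)
  then show ?case using Suc.prems by simp
qed (auto intro!: continuous_intros)

text \<open>Smoothness in one variable is witnessed by the whole sequence of derivatives: termwise
  differentiation of a power series provides it at once, and an induction along a composition can
  step from one member to the next.\<close>

definition smooth_real_on :: "real set \<Rightarrow> (real \<Rightarrow> real) \<Rightarrow> bool" where
  "smooth_real_on I f \<longleftrightarrow>
     (\<exists>\<phi>. \<phi> 0 = f \<and> (\<forall>n. \<forall>t\<in>I. (\<phi> n has_real_derivative \<phi> (Suc n) t) (at t)))"

text \<open>The index \<open>n\<close> stays arbitrary in the induction because the chain rule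
  replaces \<open>\<phi> n\<close> by \<open>\<phi> (Suc n)\<close> while the order \<open>k\<close>
  drops by one.\<close>

lemma Ck_on_compose:
  assumes "open U" "\<And>n t. t \<in> I \<Longrightarrow> (\<phi> n has_real_derivative \<phi> (Suc n) t) (at t)"
    "\<And>x. x \<in> U \<Longrightarrow> f x \<in> I"
  shows "Ck_on k U f \<Longrightarrow> Ck_on k U (\<lambda>x. \<phi> n (f x))"
proof (induction k arbitrary: n)
  case 0
  have "continuous_on I (\<phi> n)"
    using assms(2) by (meson DERIV_isCont continuous_at_imp_continuous_on)
  then show ?case
    using 0 assms(3) by (auto intro: continuous_on_compose2)
next
  case (Suc k)
  have "Ck_on k U (partial_deriv i (\<lambda>x. \<phi> n (f x)))" for i
  proof (rule Ck_on_cong[OF assms(1), of "\<lambda>x. \<phi> (Suc n) (f x) * partial_deriv i f x"])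
    show "Ck_on k U (\<lambda>x. \<phi> (Suc n) (f x) * partial_deriv i f x)"
      by (rule Ck_on_mult[OF assms(1) Suc.IH]) (use Suc.prems Ck_on_SucD in auto)
    show "\<phi> (Suc n) (f y) * partial_deriv i f y = partial_deriv i (\<lambda>x. \<phi> n (f x)) y"
      if "y \<in> U" for y
      using that Suc.prems assms(2,3) by (subst partial_deriv_compose) auto
  qed
  moreover have "(\<lambda>x. \<phi> n (f x)) differentiable (at x)" if "x \<in> U" for x
  proof (rule differentiableI[OF compose_has_derivative[of "\<phi> n" _ f, OF assms(2)[OF assms(3)[OF that]]]])
    show "f differentiable (at x)" using Suc.prems that by simp
  qed
  ultimately show ?case by simp
qed

lemma smooth_onD_differentiable: "smooth_on U f \<Longrightarrow> x \<in> U \<Longrightarrow> f differentiable (at x)"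
  by (auto simp: smooth_on_def dest!: spec[of _ "Suc 0"])

lemma smooth_onD_continuous: "smooth_on U f \<Longrightarrow> continuous_on U f"
  by (auto simp: smooth_on_def dest!: spec[of _ 0])

lemma smooth_on_partial_deriv: "smooth_on U f \<Longrightarrow> smooth_on U (partial_deriv i f)"
  unfolding smooth_on_def
proof
  fix k
  assume "\<forall>k. Ck_on k U f"
  then have "Ck_on (Suc k) U f" by blast
  then show "Ck_on k U (partial_deriv i f)" by simp
qed

lemma smooth_on_const: "smooth_on U (\<lambda>x. c)"
  by (simp add: smooth_on_def Ck_on_const)

lemma smooth_on_component: "smooth_on U (\<lambda>x. x $ j)"
  by (simp add: smooth_on_def Ck_on_component)

lemma smooth_on_add: "open U \<Longrightarrow> smooth_on U f \<Longrightarrow> smooth_on U g \<Longrightarrow> smooth_on U (\<lambda>x. f x + g x)"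
  by (simp add: smooth_on_def Ck_on_add)

lemma smooth_on_mult: "open U \<Longrightarrow> smooth_on U f \<Longrightarrow> smooth_on U g \<Longrightarrow> smooth_on U (\<lambda>x. f x * g x)"
  by (simp add: smooth_on_def Ck_on_mult)

lemma smooth_on_diff:
  assumes "open U" "smooth_on U f" "smooth_on U g"
  shows "smooth_on U (\<lambda>x. f x - g x)"
  using smooth_on_add[OF assms(1,2) smooth_on_mult[OF assms(1) smooth_on_const[of U "-1"] assms(3)]]
  by simp

lemma smooth_on_power: "open U \<Longrightarrow> smooth_on U f \<Longrightarrow> smooth_on U (\<lambda>x. f x ^ n)"
  by (induction n) (simp_all add: smooth_on_const smooth_on_mult)

lemma smooth_on_compose:
  assumes "open U" "smooth_real_on I \<phi>" "smooth_on U f" "\<And>x. x \<in> U \<Longrightarrow> f x \<in> I"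
  shows "smooth_on U (\<lambda>x. \<phi> (f x))"
proof -
  obtain \<psi> where "\<psi> 0 = \<phi>" "\<forall>n. \<forall>t\<in>I. (\<psi> n has_real_derivative \<psi> (Suc n) t) (at t)"
    using assms(2) by (auto simp: smooth_real_on_def)
  then show ?thesis
    using Ck_on_compose[OF assms(1), of I \<psi> f _ 0] assms(3,4) unfolding smooth_on_def by auto
qed

text \<open>Applying \<open>diffs\<close> keeps the interval of convergence, so its iterates give
  all derivatives.\<close>

lemma smooth_real_on_power_series:
  assumes "\<And>t. t \<in> I \<Longrightarrow> \<bar>t\<bar> < K" "\<And>t::real. \<bar>t\<bar> < K \<Longrightarrow> summable (\<lambda>n. c n * t ^ n)"
  shows "smooth_real_on I (\<lambda>t. \<Sum>n. c n * t ^ n)"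
  unfolding smooth_real_on_def
proof (intro exI conjI allI ballI)
  let ?\<phi> = "\<lambda>k t. \<Sum>n. (diffs ^^ k) c n * t ^ n"
  show "?\<phi> 0 = (\<lambda>t. \<Sum>n. c n * t ^ n)" by simp
  fix k t assume "t \<in> I"
  have "\<forall>t. \<bar>t\<bar> < K \<longrightarrow> summable (\<lambda>n. (diffs ^^ k) c n * t ^ n)"
  proof (induction k)
    case (Suc k)
    then show ?case using termdiff_converges[of _ K "(diffs ^^ k) c"] by simp
  qed (simp add: assms)
  then show "(?\<phi> k has_real_derivative ?\<phi> (Suc k) t) (at t)"
    using termdiffs_strong'[of K "(diffs ^^ k) c" t] assms(1)[OF \<open>t \<in> I\<close>] by simp
qed

lemma smooth_real_on_inverse: "smooth_real_on {0<..} inverse"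
  unfolding smooth_real_on_def
proof (intro exI conjI allI ballI)
  let ?\<phi> = "\<lambda>n (t::real). (-1) ^ n * fact n * inverse t ^ Suc n"
  show "?\<phi> 0 = inverse" by auto
  fix n and t :: real assume t: "t \<in> {0<..}"
  show "(?\<phi> n has_real_derivative ?\<phi> (Suc n) t) (at t)"
    by (rule derivative_eq_intros refl | use t in simp)+
qed

lemma smooth_on_inverse:
  "open U \<Longrightarrow> smooth_on U f \<Longrightarrow> (\<And>x. x \<in> U \<Longrightarrow> f x > 0) \<Longrightarrow> smooth_on U (\<lambda>x. inverse (f x))"
  by (rule smooth_on_compose[OF _ smooth_real_on_inverse]) auto

section \<open>The Laplacian in geodesic normal coordinates\<close>

text \<open>For t > 0 the three series are sinh (sqrt t) / sqrt t, the quotient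
  (\<open>shc t\<close> - 1) / t, and cosh (sqrt t). Being entire in t, they stay smooth when t is
  the squared norm, although the norm itself is not smooth at the center.\<close>

definition shc :: "real \<Rightarrow> real" where "shc t = (\<Sum>n. inverse (fact (2 * n + 1)) * t ^ n)"

definition shd :: "real \<Rightarrow> real" where "shd t = (\<Sum>n. inverse (fact (2 * n + 3)) * t ^ n)"

definition chc :: "real \<Rightarrow> real" where "chc t = (\<Sum>n. inverse (fact (2 * n)) * t ^ n)"

lemma summable_fact_subseq:
  assumes "\<And>n. n \<le> k n"
  shows "summable (\<lambda>n. inverse (fact (k n)) * t ^ n :: real)"
proof (rule summable_comparison_test[OF _ summable_exp[of "\<bar>t\<bar>"]])
  have "inverse (fact (k n)) \<le> (inverse (fact n) :: real)" for n
    using fact_mono[OF assms[of n], where 'a = real] by (simp add: le_imp_inverse_le)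
  then show "\<exists>N. \<forall>n\<ge>N. norm (inverse (fact (k n)) * t ^ n) \<le> inverse (fact n) * \<bar>t\<bar> ^ n"
    by (auto simp: abs_mult power_abs intro!: mult_right_mono)
qed

lemma sinh_eq_shc: "sinh r = r * shc (r\<^sup>2)"
proof -
  have "(\<lambda>n. (\<lambda>n. if even n then 0 else r ^ n /\<^sub>R fact n) (2 * n + 1)) sums sinh r"
    by (subst sums_mono_reindex)
       (auto simp: strict_mono_def sinh_converges elim!: oddE)
  then have "(\<lambda>n. r * (inverse (fact (2 * n + 1)) * (r\<^sup>2) ^ n)) sums sinh r"
    by (simp add: power_mult[symmetric] mult_ac)
  moreover have "(\<lambda>n. r * (inverse (fact (2 * n + 1)) * (r\<^sup>2) ^ n)) sums (r * shc (r\<^sup>2))"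
    unfolding shc_def by (intro sums_mult summable_sums summable_fact_subseq) simp
  ultimately show ?thesis by (rule sums_unique2)
qed

lemma cosh_eq_chc: "cosh r = chc (r\<^sup>2)"
proof -
  have "(\<lambda>n. (\<lambda>n. if even n then r ^ n /\<^sub>R fact n else 0) (2 * n)) sums cosh r"
    by (subst sums_mono_reindex) (auto simp: strict_mono_def cosh_converges)
  then have "(\<lambda>n. inverse (fact (2 * n)) * (r\<^sup>2) ^ n) sums cosh r"
    by (simp add: power_mult[symmetric] mult_ac)
  moreover have "(\<lambda>n. inverse (fact (2 * n)) * (r\<^sup>2) ^ n) sums chc (r\<^sup>2)"
    unfolding chc_def by (intro summable_sums summable_fact_subseq) simp
  ultimately show ?thesis by (rule sums_unique2)
qed

lemma shc_eq_shd: "shc t = 1 + t * shd t"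
proof -
  have "shc t = 1 + (\<Sum>n. inverse (fact (2 * Suc n + 1)) * t ^ Suc n)"
    unfolding shc_def by (subst suminf_split_head[OF summable_fact_subseq]) auto
  also have "(\<Sum>n. inverse (fact (2 * Suc n + 1)) * t ^ Suc n) =
      (\<Sum>n. t * (inverse (fact (2 * n + 3)) * t ^ n))"
    by (intro arg_cong[where f = suminf] ext)
       (simp add: eval_nat_numeral del: fact_Suc)
  also have "\<dots> = t * shd t"
    unfolding shd_def by (intro suminf_mult summable_fact_subseq) simp
  finally show ?thesis .
qed

lemma shc_ge_1: "t \<ge> 0 \<Longrightarrow> shc t \<ge> 1"
  unfolding shc_eq_shd shd_def
  by (auto intro!: mult_nonneg_nonneg suminf_nonneg summable_fact_subseq)

lemma chc_ge_1: "t \<ge> 0 \<Longrightarrow> chc t \<ge> 1"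
  using cosh_eq_chc[of "sqrt t"] cosh_real_ge_1[of "sqrt t"] by simp

lemma smooth_real_on_series: "smooth_real_on UNIV shc" "smooth_real_on UNIV shd" "smooth_real_on UNIV chc"
proof -
  have *: "smooth_real_on UNIV (\<lambda>t. \<Sum>n. inverse (fact (k n)) * t ^ n)"
    if "\<And>n. n \<le> k n" for k :: "nat \<Rightarrow> nat"
    unfolding smooth_real_on_def
  proof (intro exI conjI allI ballI)
    let ?c = "\<lambda>n. inverse (fact (k n)) :: real"
    let ?\<phi> = "\<lambda>j t. \<Sum>n. (diffs ^^ j) ?c n * t ^ n"
    show "?\<phi> 0 = (\<lambda>t. \<Sum>n. ?c n * t ^ n)" by simp
    fix j and t :: real
    have "\<forall>t. summable (\<lambda>n. (diffs ^^ j) ?c n * t ^ n)"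
    proof (induction j)
      case 0
      then show ?case using summable_fact_subseq[of k] that by simp
    next
      case (Suc j)
      then show ?case using termdiff_converges_all[of "(diffs ^^ j) ?c"] by simp
    qed
    then show "(?\<phi> j has_real_derivative ?\<phi> (Suc j) t) (at t)"
      using termdiffs_strong_converges_everywhere[of "(diffs ^^ j) ?c" t] by simp
  qed
  show "smooth_real_on UNIV shc" "smooth_real_on UNIV shd" "smooth_real_on UNIV chc"
    using *[of "\<lambda>n. 2 * n + 1"] *[of "\<lambda>n. 2 * n + 3"] *[of "\<lambda>n. 2 * n"]
    unfolding shc_def[abs_def] shd_def[abs_def] chc_def[abs_def] by simp_all
qed

section \<open>Radial coefficients of the metric as smooth functions of the squared norm\<close>

definition sqnorm :: "real ^ 2 \<Rightarrow> real" where "sqnorm x = (x $ 1)\<^sup>2 + (x $ 2)\<^sup>2"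

lemma sqnorm_eq: "sqnorm x = (norm x)\<^sup>2"
  by (simp add: sqnorm_def norm_vec_def L2_set_def sum_2)

lemma sqnorm_nonneg [simp]: "sqnorm x \<ge> 0"
  by (simp add: sqnorm_def)

lemma sqnorm_pos: "x \<noteq> 0 \<Longrightarrow> sqnorm x > 0"
  by (simp add: sqnorm_eq)

lemma smooth_on_sqnorm: "open U \<Longrightarrow> smooth_on U sqnorm"
  unfolding sqnorm_def[abs_def] by (intro smooth_on_add smooth_on_power smooth_on_component)

definition beta :: "real ^ 2 \<Rightarrow> real" where "beta x = shc (sqnorm x)"

text \<open>The smooth extension of (beta^2 - 1) / |x|^2 to the center; it is the coefficient of x
  x^T in beta^2 times the inverse metric.\<close>

definition gamma :: "real ^ 2 \<Rightarrow> real" where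
  "gamma x = shd (sqnorm x) * (2 + sqnorm x * shd (sqnorm x))"

lemma sqnorm_gamma: "sqnorm x * gamma x = (beta x)\<^sup>2 - 1"
  unfolding beta_def gamma_def shc_eq_shd by algebra

lemma beta_ge_1: "beta x \<ge> 1"
  by (simp add: beta_def shc_ge_1)

lemma beta_pos [simp]: "beta x > 0" and beta_nonzero [simp]: "beta x \<noteq> 0"
  using beta_ge_1[of x] by linarith+

lemma sinh_norm: "sinh (norm x) = norm x * beta x"
  by (simp add: sinh_eq_shc beta_def sqnorm_eq)

lemma smooth_on_beta: "open U \<Longrightarrow> smooth_on U beta"
  unfolding beta_def[abs_def]
  by (rule smooth_on_compose[OF _ smooth_real_on_series(1) smooth_on_sqnorm]) auto

lemma smooth_on_gamma: "open U \<Longrightarrow> smooth_on U gamma"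
  unfolding gamma_def[abs_def]
  by (intro smooth_on_mult smooth_on_add smooth_on_const smooth_on_sqnorm
      smooth_on_compose[OF _ smooth_real_on_series(2)]) auto

text \<open>The scaling field r d/dr, which unlike d/dr is smooth at the center.\<close>

definition euler :: "(real ^ 2 \<Rightarrow> real) \<Rightarrow> real ^ 2 \<Rightarrow> real" where
  "euler u x = x $ 1 * partial_deriv 1 u x + x $ 2 * partial_deriv 2 u x"

definition rotat :: "(real ^ 2 \<Rightarrow> real) \<Rightarrow> real ^ 2 \<Rightarrow> real" where
  "rotat u x = x $ 1 * partial_deriv 2 u x - x $ 2 * partial_deriv 1 u x"

text \<open>In polar coordinates \<open>bfield\<close> is \<open>sinh r d/dr\<close> and \<open>rotat\<close> is \<open>d/dtheta\<close>, so that the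
  Laplacian becomes the sum of their squares divided by \<open>sinh\<^sup>2 r\<close>.\<close>

definition bfield :: "(real ^ 2 \<Rightarrow> real) \<Rightarrow> real ^ 2 \<Rightarrow> real" where
  "bfield u x = beta x * euler u x"

lemma smooth_on_euler: "open U \<Longrightarrow> smooth_on U u \<Longrightarrow> smooth_on U (euler u)"
  unfolding euler_def[abs_def]
  by (intro smooth_on_add smooth_on_mult smooth_on_component smooth_on_partial_deriv)

lemma smooth_on_rotat: "open U \<Longrightarrow> smooth_on U u \<Longrightarrow> smooth_on U (rotat u)"
  unfolding rotat_def[abs_def]
  by (intro smooth_on_diff smooth_on_mult smooth_on_component smooth_on_partial_deriv)

lemma smooth_on_bfield: "open U \<Longrightarrow> smooth_on U u \<Longrightarrow> smooth_on U (bfield u)"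
  unfolding bfield_def[abs_def] by (intro smooth_on_mult smooth_on_beta smooth_on_euler)

lemma derivation_mult:
  assumes "f differentiable (at x)" "g differentiable (at x)"
  shows "rotat (\<lambda>x. f x * g x) x = f x * rotat g x + rotat f x * g x"
    and "bfield (\<lambda>x. f x * g x) x = f x * bfield g x + bfield f x * g x"
  using assms by (simp_all add: rotat_def bfield_def euler_def partial_deriv_mult algebra_simps)

lemma derivation_compose:
  assumes "(\<phi> has_real_derivative D) (at (f x))" "f differentiable (at x)"
  shows "rotat (\<lambda>x. \<phi> (f x)) x = D * rotat f x" "bfield (\<lambda>x. \<phi> (f x)) x = D * bfield f x"
  by (simp_all add: rotat_def bfield_def euler_def partial_deriv_compose[of \<phi> D f x, OF assms]
      algebra_simps)

lemma partial_deriv_sqnorm: "partial_deriv i sqnorm x = 2 * x $ i"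
proof -
  have "partial_deriv i (\<lambda>x. x $ 1 * x $ 1 + x $ 2 * x $ 2) x = 2 * x $ i"
    using exhaust_2[of i]
    by (subst partial_deriv_add) (auto simp: partial_deriv_mult partial_deriv_component)
  then show ?thesis by (simp add: sqnorm_def[abs_def] power2_eq_square)
qed

lemma differentiable_sqnorm: "sqnorm differentiable (at x)"
  using smooth_onD_differentiable[OF smooth_on_sqnorm[of UNIV]] by simp

lemma rotat_radial:
  assumes "(\<phi> has_real_derivative D) (at (sqnorm x))"
  shows "rotat (\<lambda>x. \<phi> (sqnorm x)) x = 0"
  using derivation_compose(1)[of \<phi> D sqnorm x, OF assms differentiable_sqnorm]
  by (simp add: rotat_def partial_deriv_sqnorm)

lemma bfield_radial:
  assumes "(\<phi> has_real_derivative D) (at (sqnorm x))"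
  shows "bfield (\<lambda>x. \<phi> (sqnorm x)) x = 2 * beta x * sqnorm x * D"
  using derivation_compose(2)[of \<phi> D sqnorm x, OF assms differentiable_sqnorm]
  by (simp add: bfield_def euler_def partial_deriv_sqnorm sqnorm_def power2_eq_square algebra_simps)

section \<open>The metric matrix, its inverse and the divergence form of the Laplacian\<close>

lemma matrix_inv_eq:
  assumes "A ** B = mat 1" "B ** A = mat 1"
  shows "matrix_inv A = B"
proof -
  have "A ** matrix_inv A = mat 1 \<and> matrix_inv A ** A = mat 1"
    unfolding matrix_inv_def by (rule someI[of _ B]) (use assms in simp)
  then show ?thesis
    by (metis assms(2) matrix_mul_assoc matrix_mul_lid matrix_mul_rid)
qed

lemma hyperbolic_metric_entry:
  assumes "x \<noteq> 0"
  shows "hyperbolic_metric x $ i $ j = (x $ i * x $ j +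
    (beta x)\<^sup>2 * ((vector [- x $ 2, x $ 1] :: real ^ 2) $ i * (vector [- x $ 2, x $ 1] :: real ^ 2) $ j)) / sqnorm x"
  using assms unfolding sqnorm_eq
  by (simp add: hyperbolic_metric_def dr_def dtheta_def sinh_norm power_mult_distrib
      field_simps power2_eq_square)

text \<open>The radial direction has the eigenvalue 1 and the angular direction the eigenvalue
  beta^2; clearing the denominator |x|^2 leaves a polynomial identity.\<close>

lemma det_hyperbolic_metric: "det (hyperbolic_metric x) = (beta x)\<^sup>2"
proof (cases "x = 0")
  case True
  then show ?thesis
    by (simp add: hyperbolic_metric_def beta_def shc_eq_shd sqnorm_def)
next
  case False
  let ?a = "x $ 1" and ?b = "x $ 2" and ?e = "beta x" and ?s = "sqnorm x"
  have s: "?s \<noteq> 0" using sqnorm_pos[OF False] by simp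
  have "det (hyperbolic_metric x) * ?s\<^sup>2 =
      (?a * ?a + ?e\<^sup>2 * (?b * ?b)) * (?b * ?b + ?e\<^sup>2 * (?a * ?a)) -
      (?a * ?b - ?e\<^sup>2 * (?a * ?b)) * (?a * ?b - ?e\<^sup>2 * (?a * ?b))"
    using s by (simp add: det_2 hyperbolic_metric_entry[OF False] vector_2 field_simps
        power2_eq_square)
  also have "\<dots> = ?e\<^sup>2 * ?s\<^sup>2" unfolding sqnorm_def by algebra
  finally show ?thesis using s by simp
qed

text \<open>Radial and angular directions are orthogonal eigendirections, so inversion only replaces
  the angular eigenvalue beta^2 by its reciprocal.\<close>

lemma matrix_inv_hyperbolic_metric:
  assumes "x \<noteq> 0"
  shows "matrix_inv (hyperbolic_metric x) = (\<chi> i j. (x $ i * x $ j +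
    inverse ((beta x)\<^sup>2) *
      ((vector [- x $ 2, x $ 1] :: real ^ 2) $ i * (vector [- x $ 2, x $ 1] :: real ^ 2) $ j))
    / sqnorm x)"
    (is "_ = ?B")
proof (rule matrix_inv_eq)
  let ?a = "x $ 1" and ?b = "x $ 2"
  define s e f where "s = sqnorm x" and "e = (beta x)\<^sup>2" and "f = inverse e"
  have "s \<noteq> 0" using sqnorm_pos[OF assms] by (simp add: s_def)
  moreover have "s = ?a * ?a + ?b * ?b" by (simp add: s_def sqnorm_def power2_eq_square)
  ultimately have s: "s \<noteq> 0" "s = ?a * ?a + ?b * ?b" .
  have ef: "e * f = 1" by (simp add: e_def f_def)
  \<comment> \<open>Clears the common denominator, so that every matrix entry becomes a polynomial
    identity modulo \<open>ef\<close> and \<open>s(2)\<close>.\<close>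
  have *: "p / s * (q / s) + p' / s * (q' / s) = c" if "p * q + p' * q' = c * (s * s)" for p p' q q' c
    using that s(1) by (simp add: field_simps)
  have ne: "(1::2) \<noteq> 2" "(2::2) \<noteq> 1" by simp_all
  note entries = vec_eq_iff forall_2 matrix_matrix_mult_def sum_2 mat_def
      hyperbolic_metric_entry[OF assms] vec_lambda_beta vector_2 ne refl if_True if_False
      s_def[symmetric] e_def[symmetric] f_def[symmetric]
  show "hyperbolic_metric x ** ?B = mat 1"
    by (simp only: entries; intro conjI *; insert ef s(2); algebra)
  show "?B ** hyperbolic_metric x = mat 1"
    by (simp only: entries; intro conjI *; insert ef s(2); algebra)
qed

text \<open>If y is x turned by a right angle, then y y^T = |x|^2 I - x x^T, so the inverse metric
  is (I + gamma x x^T) / beta^2, and the volume density beta cancels one factor. Nothing is divided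
  by |x|^2 any more, so the right-hand side is smooth at the center as well.\<close>

lemma flux_hyperbolic_metric:
  "sqrt (det (hyperbolic_metric x)) * grad hyperbolic_metric u x $ i =
     (partial_deriv i u x + gamma x * (x $ i * euler u x)) * inverse (beta x)"
proof (cases "x = 0")
  case True
  have "matrix_inv (mat 1 :: real ^ 2 ^ 2) = mat 1"
    by (rule matrix_inv_eq) simp_all
  with True show ?thesis
    by (simp add: det_hyperbolic_metric grad_def hyperbolic_metric_def beta_def sqnorm_def shc_eq_shd)
next
  case False
  let ?a = "x $ 1" and ?b = "x $ 2"
  define s e where "s = sqnorm x" and "e = beta x"
  have "s \<noteq> 0" using sqnorm_pos[OF False] by (simp add: s_def)
  moreover have "s = ?a * ?a + ?b * ?b" by (simp add: s_def sqnorm_def power2_eq_square)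
  ultimately have s: "s \<noteq> 0" "s = ?a * ?a + ?b * ?b" .
  have e: "e \<noteq> 0" "s * gamma x = e * e - 1"
    using sqnorm_gamma[of x] by (simp_all add: e_def s_def power2_eq_square)
  have "sqrt (det (hyperbolic_metric x)) = e"
    by (simp add: det_hyperbolic_metric e_def less_imp_le)
  moreover have "e * grad hyperbolic_metric u x $ i =
      (partial_deriv i u x + gamma x * (x $ i * euler u x)) * inverse e"
  proof -
    define f t where "f = inverse e" and "t = inverse s"
    have ef: "e * f = 1" and st: "s * t = 1" using s e by (simp_all add: f_def t_def)
    have g: "gamma x = (e * e - 1) * t"
      unfolding e(2)[symmetric] using st by (simp add: mult_ac)
    have "grad hyperbolic_metric u x $ i = (\<Sum>j\<in>UNIV. ((x $ i * x $ j + f * f *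
        ((vector [- ?b, ?a] :: real ^ 2) $ i * (vector [- ?b, ?a] :: real ^ 2) $ j)) * t)
          * partial_deriv j u x)"
      unfolding grad_def matrix_inv_hyperbolic_metric[OF False] matrix_vector_mult_def
      by (simp add: f_def t_def e_def s_def divide_inverse power2_eq_square)
    then have "i = 1 \<and> grad hyperbolic_metric u x $ i =
        (?a * ?a + f * f * (?b * ?b)) * t * partial_deriv 1 u x +
        (?a * ?b - f * f * (?b * ?a)) * t * partial_deriv 2 u x \<or>
      i = 2 \<and> grad hyperbolic_metric u x $ i =
        (?b * ?a - f * f * (?a * ?b)) * t * partial_deriv 1 u x +
        (?b * ?b + f * f * (?a * ?a)) * t * partial_deriv 2 u x"
      using exhaust_2[of i] by (auto simp: sum_2 vector_2)
    then show ?thesis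
    proof (elim disjE conjE)
      show ?thesis if i: "i = 1" and *: "grad hyperbolic_metric u x $ i =
        (?a * ?a + f * f * (?b * ?b)) * t * partial_deriv 1 u x +
        (?a * ?b - f * f * (?b * ?a)) * t * partial_deriv 2 u x"
        unfolding * unfolding g euler_def f_def[symmetric] i using ef st s(2) by algebra
      show ?thesis if i: "i = 2" and *: "grad hyperbolic_metric u x $ i =
        (?b * ?a - f * f * (?a * ?b)) * t * partial_deriv 1 u x +
        (?b * ?b + f * f * (?a * ?a)) * t * partial_deriv 2 u x"
        unfolding * unfolding g euler_def f_def[symmetric] i using ef st s(2) by algebra
    qed
  qed
  ultimately show ?thesis by (simp add: e_def)
qed

definition flux :: "(real ^ 2 \<Rightarrow> real) \<Rightarrow> 2 \<Rightarrow> real ^ 2 \<Rightarrow> real" where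
  "flux u i x = (partial_deriv i u x + gamma x * (x $ i * euler u x)) * inverse (beta x)"

lemma hyp_laplacian_flux:
  "hyp_laplacian u x = (partial_deriv 1 (flux u 1) x + partial_deriv 2 (flux u 2) x) * inverse (beta x)"
  unfolding laplace_beltrami_def divergence_def flux_hyperbolic_metric
  by (simp add: sum_2 flux_def[abs_def] det_hyperbolic_metric less_imp_le divide_inverse)

lemma smooth_on_inverse_beta: "open U \<Longrightarrow> smooth_on U (\<lambda>x. inverse (beta x))"
  by (intro smooth_on_inverse smooth_on_beta) auto

lemma smooth_on_flux: "open U \<Longrightarrow> smooth_on U u \<Longrightarrow> smooth_on U (flux u i)"
  unfolding flux_def[abs_def]
  by (intro smooth_on_mult smooth_on_add smooth_on_component smooth_on_euler smooth_on_gamma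
      smooth_on_inverse_beta smooth_on_partial_deriv)

lemma smooth_on_hyp_laplacian: "open U \<Longrightarrow> smooth_on U u \<Longrightarrow> smooth_on U (hyp_laplacian u)"
  unfolding hyp_laplacian_flux[abs_def]
  by (intro smooth_on_mult smooth_on_add smooth_on_inverse_beta smooth_on_flux smooth_on_partial_deriv)

lemma hyp_laplacian_cong:
  assumes "open U" "x \<in> U" "\<And>y. y \<in> U \<Longrightarrow> f y = g y"
  shows "hyp_laplacian f x = hyp_laplacian g x"
proof -
  have "flux f i y = flux g i y" if "y \<in> U" for i y
    using partial_deriv_cong_open[OF assms(1) that assms(3)]
    by (simp add: flux_def euler_def)
  then show ?thesis
    using partial_deriv_cong_open[OF assms(1,2), of "flux f 1" "flux g 1"]
      partial_deriv_cong_open[OF assms(1,2), of "flux f 2" "flux g 2"]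
    by (simp add: hyp_laplacian_flux)
qed

text \<open>Computing the divergence of \<open>|x|\<^sup>2\<close> times the flux avoids dividing by \<open>|x|\<^sup>2\<close>, so that the
  identity also holds at the center.\<close>

lemma hyp_laplacian_eq:
  assumes "open U" "smooth_on U u" "x \<in> U"
  shows "sqnorm x * (beta x)\<^sup>2 * hyp_laplacian u x = bfield (bfield u) x + rotat (rotat u) x"
proof -
  \<comment> \<open>The angular component: |x|^2 times the flux is x times \<open>bfield u\<close>
    plus x turned by a right angle times \<open>w\<close>.\<close>
  define w where "w = (\<lambda>y. inverse (beta y) * rotat u y)"
  have D: "f differentiable (at x)" if "smooth_on U f" for f
    using smooth_onD_differentiable[OF that assms(3)] .
  have smooth: "smooth_on U (flux u i)" "smooth_on U (bfield u)" "smooth_on U (rotat u)"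
    "smooth_on U (\<lambda>y. inverse (beta y))" "smooth_on U w" for i
    unfolding w_def
    by (intro smooth_on_mult smooth_on_flux smooth_on_bfield smooth_on_rotat smooth_on_inverse_beta assms(1,2))+
  have flux: "sqnorm y * flux u 1 y = y $ 1 * bfield u y - y $ 2 * w y"
    "sqnorm y * flux u 2 y = y $ 2 * bfield u y + y $ 1 * w y" for y
  proof -
    have n: "sqnorm y = y $ 1 * y $ 1 + y $ 2 * y $ 2" by (simp add: sqnorm_def power2_eq_square)
    have "sqnorm y * flux u i y = (sqnorm y * partial_deriv i u y +
        (beta y * beta y - 1) * (y $ i * euler u y)) * inverse (beta y)" for i
      unfolding power2_eq_square[symmetric] sqnorm_gamma[symmetric]
      by (simp add: flux_def algebra_simps)
    from this[of 1] this[of 2] show "sqnorm y * flux u 1 y = y $ 1 * bfield u y - y $ 2 * w y"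
      "sqnorm y * flux u 2 y = y $ 2 * bfield u y + y $ 1 * w y"
      by (simp_all add: n w_def bfield_def rotat_def euler_def field_simps)
  qed
  have dist: "partial_deriv i (\<lambda>y. sqnorm y * flux u i y) x =
      sqnorm x * partial_deriv i (flux u i) x + 2 * (x $ i * flux u i x)" for i
    by (subst partial_deriv_mult)
       (simp_all add: D smooth differentiable_sqnorm partial_deriv_sqnorm)
  have 1: "partial_deriv 1 (\<lambda>y. sqnorm y * flux u 1 y) x =
      bfield u x + x $ 1 * partial_deriv 1 (bfield u) x - x $ 2 * partial_deriv 1 w x"
    unfolding flux
    by (simp add: partial_deriv_diff partial_deriv_mult partial_deriv_component D smooth)
  have 2: "partial_deriv 2 (\<lambda>y. sqnorm y * flux u 2 y) x =
      bfield u x + x $ 2 * partial_deriv 2 (bfield u) x + x $ 1 * partial_deriv 2 w x"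
    unfolding flux
    by (simp add: partial_deriv_add partial_deriv_mult partial_deriv_component D smooth)
  have xflux: "x $ 1 * flux u 1 x + x $ 2 * flux u 2 x = bfield u x"
  proof -
    have "x $ 1 * flux u 1 x + x $ 2 * flux u 2 x =
        (1 + sqnorm x * gamma x) * euler u x * inverse (beta x)"
      by (simp add: flux_def euler_def sqnorm_def power2_eq_square algebra_simps)
    then show ?thesis
      unfolding sqnorm_gamma by (simp add: bfield_def field_simps power2_eq_square)
  qed
  \<comment> \<open>The factor 1 / beta is radial, so the angular derivative passes through
    it.\<close>
  have w: "rotat w x = inverse (beta x) * rotat (rotat u) x"
  proof -
    obtain \<phi> where "\<phi> 0 = shc" "\<forall>n t. (\<phi> n has_real_derivative \<phi> (Suc n) t) (at t)"
      using smooth_real_on_series(1) by (auto simp: smooth_real_on_def)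
    then have "(shc has_real_derivative \<phi> 1 (sqnorm x)) (at (sqnorm x))" by (metis One_nat_def)
    then have "((\<lambda>t. inverse (shc t)) has_real_derivative
        - \<phi> 1 (sqnorm x) * inverse (shc (sqnorm x) * shc (sqnorm x))) (at (sqnorm x))"
      using beta_nonzero[of x] unfolding beta_def
      by (auto intro!: derivative_eq_intros simp: field_simps)
    from rotat_radial[OF this] have "rotat (\<lambda>y. inverse (beta y)) x = 0"
      by (simp add: beta_def[abs_def])
    then show ?thesis
      unfolding w_def by (simp add: derivation_mult D smooth)
  qed
  have bl: "beta x * hyp_laplacian u x =
      partial_deriv 1 (flux u 1) x + partial_deriv 2 (flux u 2) x"
    by (simp add: hyp_laplacian_flux)
  \<comment> \<open>One term 2 \<open>bfield u\<close> comes from the gradient of |x|^2, the other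
    from div x = 2; they cancel.\<close>
  have "sqnorm x * (beta x * hyp_laplacian u x) + 2 * bfield u x =
      2 * bfield u x + euler (bfield u) x + rotat w x"
    using dist[of 1] dist[of 2] 1 2 unfolding bl
    by (simp add: xflux[symmetric] euler_def rotat_def algebra_simps)
  then have "sqnorm x * (beta x * hyp_laplacian u x) = euler (bfield u) x + rotat w x" by simp
  then have "beta x * (sqnorm x * (beta x * hyp_laplacian u x)) =
      bfield (bfield u) x + beta x * (inverse (beta x) * rotat (rotat u) x)"
    by (simp add: w bfield_def[of "bfield u"] algebra_simps)
  then show ?thesis by (simp add: power2_eq_square algebra_simps)
qed

section \<open>The explicit eigenfunctions\<close>

lemma tanh_half: "tanh (r / 2 :: real) = sinh r / (1 + cosh r)"
proof -
  have "sinh r = 2 * sinh (r / 2) * cosh (r / 2)" using sinh_double[of "r / 2"] by simp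
  moreover have "1 + cosh r = 2 * cosh (r / 2) * cosh (r / 2)"
    using cosh_double_cosh[of "r / 2"] by (simp add: power2_eq_square)
  ultimately show ?thesis by (simp add: tanh_def)
qed

lemma tanh_half_squared: "(tanh (r / 2 :: real))\<^sup>2 = (cosh r - 1) / (cosh r + 1)"
proof -
  have "1 + cosh r \<noteq> 0" using cosh_real_pos[of r] by linarith
  moreover have "(sinh r)\<^sup>2 = (cosh r - 1) * (cosh r + 1)"
    unfolding sinh_square_eq by (simp add: power2_eq_square algebra_simps)
  ultimately show ?thesis
    by (simp add: tanh_half power_divide power2_eq_square add.commute)
qed

lemma tanh_half_derivative: "((\<lambda>r. tanh (r / 2 :: real)) has_real_derivative 1 / (1 + cosh r)) (at r)"
proof -
  have c: "1 + cosh r \<noteq> 0" using cosh_real_pos[of r] by linarith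
  have "1 - (tanh (r / 2))\<^sup>2 = 2 / (1 + cosh r)"
    unfolding tanh_half_squared using c by (simp add: field_simps)
  then show ?thesis
    by (auto intro!: derivative_eq_intros simp: field_simps)
qed

text \<open>The radial factor of the eigenfunction, as a series in X = tanh^2 (r/2). The radial
  equation forces (m + n + 1) c_n = n + 1 for the coefficients c_n of the derivative, hence the
  coefficients 1 / (m + n). For m = 0 the term n = 0 is \<open>inverse 0\<close>, that is 0, which
  only fixes the additive constant.\<close>

definition psi :: "nat \<Rightarrow> real \<Rightarrow> real" where
  "psi m t = (\<Sum>n. inverse (real (m + n)) * t ^ n)"

definition psi' :: "nat \<Rightarrow> real \<Rightarrow> real" where
  "psi' m t = (\<Sum>n. diffs (\<lambda>n. inverse (real (m + n))) n * t ^ n)"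

definition psi'' :: "nat \<Rightarrow> real \<Rightarrow> real" where
  "psi'' m t = (\<Sum>n. diffs (diffs (\<lambda>n. inverse (real (m + n)))) n * t ^ n)"

lemma summable_psi:
  assumes "\<bar>t\<bar> < 1"
  shows "summable (\<lambda>n. inverse (real (m + n)) * t ^ n)"
proof (rule summable_comparison_test)
  have "inverse (real (m + n)) \<le> 1" for n
    by (cases "m + n = 0") (auto simp: inverse_le_1_iff)
  then show "\<exists>N. \<forall>n\<ge>N. norm (inverse (real (m + n)) * t ^ n) \<le> \<bar>t\<bar> ^ n"
    by (auto simp: abs_mult power_abs intro!: mult_left_le_one_le)
  show "summable (\<lambda>n. \<bar>t\<bar> ^ n)" using assms by (simp add: summable_geometric)
qed

lemma psi_derivative:
  assumes "\<bar>t\<bar> < 1"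
  shows "(psi m has_real_derivative psi' m t) (at t)"
    and "(psi' m has_real_derivative psi'' m t) (at t)"
proof -
  have "summable (\<lambda>n. diffs (\<lambda>n. inverse (real (m + n))) n * z ^ n)" if "\<bar>z\<bar> < 1" for z
    using termdiff_converges[of z 1] that summable_psi by simp
  then show "(psi m has_real_derivative psi' m t) (at t)"
    "(psi' m has_real_derivative psi'' m t) (at t)"
    unfolding psi_def[abs_def] psi'_def[abs_def] psi''_def
    by (intro termdiffs_strong'[where K = 1]; use assms summable_psi in simp)+
qed

lemma smooth_real_on_psi: "smooth_real_on {-1<..<1} (psi m)"
  unfolding psi_def[abs_def]
  by (rule smooth_real_on_power_series[where K = 1]) (auto intro!: summable_psi simp del: of_nat_add)

text \<open>The radial equation for g in T^m g(T^2) cos (m theta). Multiplying the coefficient 1 /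
  (m + n) by n + m gives the geometric series, so t psi' + m psi = 1 / (1 - t) up to a constant;
  differentiating removes the constant.\<close>

lemma psi_ode:
  assumes "\<bar>t\<bar> < 1"
  shows "(real m + 1) * psi' m t + t * psi'' m t = 1 / (1 - t)\<^sup>2"
proof -
  \<comment> \<open>Since \<open>inverse 0\<close> is 0, the constant term of the geometric series
    is missing exactly for \<open>m = 0\<close>.\<close>
  define k :: real where "k = (if m = 0 then 1 else 0)"
  have eq: "t * psi' m t + real m * psi m t = 1 / (1 - t) - k" if t: "t \<in> {-1<..<1}" for t
  proof -
    let ?c = "\<lambda>n. inverse (real (m + n))"
    have t: "\<bar>t\<bar> < 1" using t by auto
    have "summable (\<lambda>n. diffs ?c n * t ^ n)"
      using termdiff_converges[of t 1 ?c] t summable_psi by simp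
    from sums_mult[OF diffs_equiv[OF this], of t]
    have "(\<lambda>n. t * (real n * ?c n * t ^ (n - Suc 0))) sums (t * psi' m t)"
      unfolding psi'_def by simp
    also have "(\<lambda>n. t * (real n * ?c n * t ^ (n - Suc 0))) = (\<lambda>n. real n * ?c n * t ^ n)"
      by (rule ext) (case_tac n; simp)
    finally have "(\<lambda>n. real n * ?c n * t ^ n + real m * (?c n * t ^ n)) sums
        (t * psi' m t + real m * psi m t)"
      unfolding psi_def by (intro sums_add sums_mult summable_sums summable_psi t)
    also have "(\<lambda>n. real n * ?c n * t ^ n + real m * (?c n * t ^ n)) =
        (\<lambda>n. t ^ n - (if n = 0 then k else 0))"
    proof
      fix n
      show "real n * ?c n * t ^ n + real m * (?c n * t ^ n) = t ^ n - (if n = 0 then k else 0)"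
      proof (cases "m + n = 0")
        case False
        then have "real n * ?c n + real m * ?c n = 1"
          by (metis add.commute distrib_right of_nat_add of_nat_eq_0_iff right_inverse)
        then have "real n * ?c n * t ^ n + real m * (?c n * t ^ n) = t ^ n"
          by (simp flip: distrib_right mult.assoc)
        then show ?thesis using False by (auto simp: k_def)
      qed (simp add: k_def)
    qed
    finally have 1: "(\<lambda>n. t ^ n - (if n = 0 then k else 0)) sums (t * psi' m t + real m * psi m t)" .
    have "(\<lambda>n. t ^ n - (if n = 0 then k else 0)) sums (1 / (1 - t) - k)"
      by (intro sums_diff geometric_sums sums_single[of 0 "\<lambda>_. k"]) (use t in simp)
    with 1 show ?thesis by (rule sums_unique2)
  qed
  have "((\<lambda>t. t * psi' m t + real m * psi m t) has_real_derivative
      psi' m t + t * psi'' m t + real m * psi' m t) (at t)"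
    using psi_derivative[OF assms] by (auto intro!: derivative_eq_intros)
  then have "((\<lambda>t. 1 / (1 - t) - k) has_real_derivative
      psi' m t + t * psi'' m t + real m * psi' m t) (at t)"
    by (rule has_field_derivative_transform_within_open[where S = "{-1<..<1}"])
       (use assms eq in auto)
  moreover have "((\<lambda>t. 1 / (1 - t) - k) has_real_derivative 1 / (1 - t)\<^sup>2) (at t)"
    using assms by (auto intro!: derivative_eq_intros simp: power2_eq_square)
  ultimately have "psi' m t + t * psi'' m t + real m * psi' m t = 1 / (1 - t)\<^sup>2"
    by (rule DERIV_unique)
  then show ?thesis by (simp add: algebra_simps)
qed

text \<open>\<open>F m R\<close> is the integral of \<open>tanh (r/2) ^ (2 * m) * sinh r\<close> over \<open>0 \<le> r \<le> R\<close>.\<close>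

definition F :: "nat \<Rightarrow> real \<Rightarrow> real" where
  "F m R = 2 * tanh (R / 2) ^ (2 * m + 2) * psi' m ((tanh (R / 2))\<^sup>2)"

lemma F_0 [simp]: "F m 0 = 0"
  by (simp add: F_def)

lemma tanh_half_squared_less_1: "(tanh (r / 2 :: real))\<^sup>2 < 1"
  using tanh_real_bounds[of "r / 2"] by (simp add: abs_square_less_1 abs_less_iff)

text \<open>In the variable X = tanh^2 (r/2), the form tanh^(2 m) (r/2) sinh r dr becomes 2 X^m / (1
  - X)^2 dX, which by \<open>psi_ode\<close> is the differential of 2 X^(m + 1) psi'(X).\<close>

lemma F_derivative: "(F m has_real_derivative tanh (r / 2) ^ (2 * m) * sinh r) (at r)"
proof -
  let ?X = "\<lambda>r::real. (tanh (r / 2))\<^sup>2"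
  define c T X where "c = cosh r" and "T = tanh (r / 2)" and "X = ?X r"
  have F_eq: "F m = (\<lambda>r. 2 * (?X r ^ (m + 1) * psi' m (?X r)))"
    unfolding F_def power_mult[symmetric] by (simp add: fun_eq_iff)
  have c: "1 + c > 0" unfolding c_def using cosh_real_pos[of r] by linarith
  have X: "\<bar>X\<bar> < 1" using tanh_half_squared_less_1[of r] by (simp add: X_def)
  have dX: "(?X has_real_derivative 2 * T / (1 + c)) (at r)"
    using DERIV_power[OF tanh_half_derivative[of r], of 2] by (simp add: T_def c_def mult_ac)
  have dpow: "((\<lambda>r. ?X r ^ (m + 1)) has_real_derivative
      real (m + 1) * X ^ m * (2 * T / (1 + c))) (at r)"
    using DERIV_power[OF dX, of "m + 1"] by (simp add: X_def mult_ac)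
  have dpsi: "((\<lambda>r. psi' m (?X r)) has_real_derivative psi'' m X * (2 * T / (1 + c))) (at r)"
    using DERIV_chain2[OF psi_derivative(2) dX] X by (simp add: X_def)
  have "((\<lambda>r. 2 * (?X r ^ (m + 1) * psi' m (?X r))) has_real_derivative
      2 * (real (m + 1) * X ^ m * (2 * T / (1 + c)) * psi' m X +
        psi'' m X * (2 * T / (1 + c)) * X ^ (m + 1))) (at r)"
    using DERIV_cmult[OF DERIV_mult[OF dpow dpsi], of 2] by (simp add: X_def)
  also have "2 * (real (m + 1) * X ^ m * (2 * T / (1 + c)) * psi' m X +
        psi'' m X * (2 * T / (1 + c)) * X ^ (m + 1)) =
      X ^ m * (4 * T / (1 + c)) * ((real m + 1) * psi' m X + X * psi'' m X)"
    by (simp add: algebra_simps add_divide_distrib)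
  also have "\<dots> = X ^ m * ((4 / (1 + c) / (1 - X)\<^sup>2) * T)"
    unfolding psi_ode[OF X] by simp
  also have "1 - X = 2 / (1 + c)"
    using c by (simp add: X_def tanh_half_squared c_def[symmetric] field_simps)
  also have "4 / (1 + c) / (2 / (1 + c))\<^sup>2 = 1 + c"
    using c by (simp add: power2_eq_square)
  also have "(1 + c) * T = sinh r"
    using c by (simp add: T_def tanh_half c_def)
  also have "X ^ m = tanh (r / 2) ^ (2 * m)"
    by (simp add: X_def power_mult)
  finally show ?thesis
    unfolding F_eq .
qed

lemma F_pos:
  assumes "r > 0"
  shows "F m r > 0"
proof -
  have "F m 0 < F m r"
  proof (rule DERIV_pos_imp_increasing_open[OF assms])
    show "\<exists>y. (F m has_real_derivative y) (at x) \<and> 0 < y" if "0 < x" for x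
      using F_derivative[of m x] that by (intro exI[of _ "tanh (x / 2) ^ (2 * m) * sinh x"]) simp
    show "continuous_on {0..r} (F m)"
      by (meson F_derivative DERIV_isCont continuous_at_imp_continuous_on)
  qed
  then show ?thesis by simp
qed

text \<open>The real and imaginary parts of \<open>(x\<^sub>1 + i x\<^sub>2)\<^sup>m\<close>.\<close>

fun hre :: "nat \<Rightarrow> real ^ 2 \<Rightarrow> real" and him :: "nat \<Rightarrow> real ^ 2 \<Rightarrow> real" where
  "hre 0 x = 1"
| "him 0 x = 0"
| "hre (Suc m) x = x $ 1 * hre m x - x $ 2 * him m x"
| "him (Suc m) x = x $ 1 * him m x + x $ 2 * hre m x"

lemma smooth_on_hre_him:
  assumes "open U"
  shows "smooth_on U (hre m) \<and> smooth_on U (him m)"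
proof (induction m)
  case 0
  have "hre 0 = (\<lambda>x. 1)" "him 0 = (\<lambda>x. 0)" by auto
  then show ?case by (simp add: smooth_on_const)
next
  case (Suc m)
  then have "smooth_on U (\<lambda>x. x $ 1 * hre m x - x $ 2 * him m x)"
    "smooth_on U (\<lambda>x. x $ 1 * him m x + x $ 2 * hre m x)"
    by (auto intro!: smooth_on_diff smooth_on_add smooth_on_mult smooth_on_component assms)
  then show ?case by (simp add: fun_eq_iff[symmetric])
qed

text \<open>In polar coordinates the pair is r^m cos (m theta), r^m sin (m theta), and
  \<open>bfield\<close> turns r into beta r. The rotation derivative of each function involves its
  partner, so both are treated in one induction.\<close>

lemma derivation_hre_him:
  "rotat (hre m) x = - real m * him m x \<and> rotat (him m) x = real m * hre m x \<and>
   bfield (hre m) x = real m * beta x * hre m x \<and> bfield (him m) x = real m * beta x * him m x"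
proof (induction m)
  case 0
  have "hre 0 = (\<lambda>x. 1)" "him 0 = (\<lambda>x. 0)" by auto
  then show ?case by (simp add: rotat_def bfield_def euler_def)
next
  case (Suc m)
  have eq: "hre (Suc m) = (\<lambda>x. x $ 1 * hre m x - x $ 2 * him m x)"
    "him (Suc m) = (\<lambda>x. x $ 1 * him m x + x $ 2 * hre m x)" by auto
  have [simp]: "hre m differentiable (at x)" "him m differentiable (at x)"
    using smooth_on_hre_him[of UNIV m] smooth_onD_differentiable by auto
  have p: "partial_deriv i (hre (Suc m)) x =
      x $ 1 * partial_deriv i (hre m) x + (if i = 1 then 1 else 0) * hre m x -
      (x $ 2 * partial_deriv i (him m) x + (if i = 2 then 1 else 0) * him m x)"
    "partial_deriv i (him (Suc m)) x =
      x $ 1 * partial_deriv i (him m) x + (if i = 1 then 1 else 0) * him m x +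
      (x $ 2 * partial_deriv i (hre m) x + (if i = 2 then 1 else 0) * hre m x)" for i
    unfolding eq
    by (simp_all add: partial_deriv_diff partial_deriv_add partial_deriv_mult
        partial_deriv_component)
  have rot: "rotat (hre (Suc m)) x =
      x $ 1 * (rotat (hre m) x - him m x) - x $ 2 * (rotat (him m) x + hre m x)"
    "rotat (him (Suc m)) x =
      x $ 1 * (rotat (him m) x + hre m x) + x $ 2 * (rotat (hre m) x - him m x)"
    unfolding rotat_def p by (simp_all add: algebra_simps)
  have bf: "bfield (hre (Suc m)) x =
      x $ 1 * (bfield (hre m) x + beta x * hre m x) - x $ 2 * (bfield (him m) x + beta x * him m x)"
    "bfield (him (Suc m)) x =
      x $ 1 * (bfield (him m) x + beta x * him m x) + x $ 2 * (bfield (hre m) x + beta x * hre m x)"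
    unfolding bfield_def euler_def p by (simp_all add: algebra_simps)
  show ?case
    unfolding rot bf using Suc.IH by (simp add: algebra_simps)
qed

lemma hre_axis: "hre m (t *\<^sub>R axis 1 1) = t ^ m \<and> him m (t *\<^sub>R axis 1 1) = 0"
  by (induction m) (simp_all add: axis_def)

definition xi :: "real ^ 2 \<Rightarrow> real" where
  "xi x = (chc (sqnorm x) - 1) * inverse (1 + chc (sqnorm x))"

text \<open>The smooth extension of tanh (r/2) / r to the center; its m-th power turns r^m into
  tanh^m (r/2).\<close>

definition tau :: "real ^ 2 \<Rightarrow> real" where
  "tau x = beta x * inverse (1 + chc (sqnorm x))"

lemma chc_norm: "chc (sqnorm x) = cosh (norm x)"
  by (simp add: sqnorm_eq cosh_eq_chc)

lemma xi_norm: "xi x = (tanh (norm x / 2))\<^sup>2"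
  by (simp only: tanh_half_squared)
     (simp only: xi_def chc_norm divide_inverse add.commute[of 1 "cosh (norm x)"])

lemma tau_pos: "tau x > 0"
  unfolding tau_def
  by (intro mult_pos_pos beta_pos) (simp add: add_pos_pos less_le_trans[OF zero_less_one chc_ge_1])

lemma smooth_on_chc: "open U \<Longrightarrow> smooth_on U (\<lambda>x. chc (sqnorm x))"
  by (rule smooth_on_compose[OF _ smooth_real_on_series(3) smooth_on_sqnorm]) auto

lemma smooth_on_inverse_chc: "open U \<Longrightarrow> smooth_on U (\<lambda>x. inverse (1 + chc (sqnorm x)))"
  by (intro smooth_on_inverse smooth_on_add smooth_on_const smooth_on_chc)
     (simp_all add: add_pos_pos less_le_trans[OF zero_less_one chc_ge_1])

lemma smooth_on_xi: "open U \<Longrightarrow> smooth_on U xi"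
  unfolding xi_def[abs_def]
  by (intro smooth_on_mult smooth_on_diff smooth_on_const smooth_on_chc smooth_on_inverse_chc)

lemma smooth_on_tau: "open U \<Longrightarrow> smooth_on U tau"
  unfolding tau_def[abs_def] by (intro smooth_on_mult smooth_on_beta smooth_on_inverse_chc)

text \<open>Smoothness already provides some derivative \<open>d\<close>; differentiating cosh r =
  chc (r^2) identifies it. The comparison divides by r, whence t > 0; the center is treated
  separately where the lemma is applied.\<close>

lemma chc_derivative: "(chc has_real_derivative shc t / 2) (at t)" if "t > 0"
proof -
  obtain d where D: "(chc has_real_derivative d) (at t)"
    using smooth_real_on_series(3) unfolding smooth_real_on_def by (metis UNIV_I)
  define r where "r = sqrt t"
  have r: "r > 0" "r\<^sup>2 = t" using that by (simp_all add: r_def)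
  have "((\<lambda>r. chc (r\<^sup>2)) has_real_derivative d * (2 * r)) (at r)"
    by (rule DERIV_chain2[where g = "\<lambda>r. r\<^sup>2"]) (use D r in \<open>auto intro!: derivative_eq_intros\<close>)
  moreover have "(cosh has_real_derivative sinh r) (at r)"
    by (auto intro!: derivative_eq_intros)
  ultimately have "d * (2 * r) = sinh r"
    by (intro DERIV_unique[of cosh]) (simp_all add: cosh_eq_chc[symmetric])
  then have "d = shc t / 2" using r by (simp add: sinh_eq_shc field_simps)
  with D show ?thesis by simp
qed

lemma shc_derivative: "(shc has_real_derivative (chc t - shc t) / (2 * t)) (at t)" if "t > 0"
proof -
  obtain d where D: "(shc has_real_derivative d) (at t)"
    using smooth_real_on_series(1) unfolding smooth_real_on_def by (metis UNIV_I)
  define r where "r = sqrt t"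
  have r: "r > 0" "r\<^sup>2 = t" using that by (simp_all add: r_def)
  have "((\<lambda>r. shc (r\<^sup>2)) has_real_derivative d * (2 * r)) (at r)"
    by (rule DERIV_chain2[where g = "\<lambda>r. r\<^sup>2"]) (use D r in \<open>auto intro!: derivative_eq_intros\<close>)
  then have "((\<lambda>r. r * shc (r\<^sup>2)) has_real_derivative d * (2 * r) * r + shc t) (at r)"
    using DERIV_mult[OF DERIV_ident] r by (fastforce simp: add.commute mult_ac)
  moreover have "(sinh has_real_derivative cosh r) (at r)"
    by (auto intro!: derivative_eq_intros)
  ultimately have "d * (2 * r) * r + shc t = cosh r"
    by (intro DERIV_unique[of sinh]) (simp_all add: sinh_eq_shc[symmetric])
  then have "d * (2 * t) + shc t = chc t"
    unfolding cosh_eq_chc r(2)[symmetric] by (simp add: power2_eq_square mult_ac)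
  then have "d = (chc t - shc t) / (2 * t)" using that by (simp add: field_simps)
  with D show ?thesis by simp
qed

lemma bfield_0 [simp]: "bfield u 0 = 0"
  by (simp add: bfield_def euler_def)

lemma sqnorm_beta: "sqnorm x * (beta x)\<^sup>2 = (chc (sqnorm x))\<^sup>2 - 1"
  using sinh_square_eq[of "norm x"] unfolding chc_norm sinh_norm
  by (simp add: sqnorm_eq power_mult_distrib)

text \<open>With T = tanh (r/2), \<open>bfield\<close> maps T to T and r to beta r, while
  \<open>xi\<close> is T^2 and \<open>tau\<close> is T / r; both are radial.\<close>

lemma
  shows bfield_xi: "bfield xi x = 2 * xi x" and rotat_xi: "rotat xi x = 0"
    and bfield_tau: "bfield tau x = tau x * (1 - beta x)" and rotat_tau: "rotat tau x = 0"
proof -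
  let ?s = "sqnorm x"
  define c where "c = chc ?s"
  have c: "1 + c > 0" using chc_ge_1[of ?s] by (simp add: c_def)
  have "bfield xi x = 2 * xi x \<and> rotat xi x = 0 \<and>
    bfield tau x = tau x * (1 - beta x) \<and> rotat tau x = 0"
  proof (cases "x = 0")
    \<comment> \<open>Both vector fields vanish at the center, and so do the right-hand sides,
      because there \<open>xi\<close> is 0 and \<open>beta\<close> is 1.\<close>
    case True
    then show ?thesis
      by (simp add: rotat_def xi_def sqnorm_def cosh_eq_chc[of 0, simplified, symmetric] beta_def
          shc_eq_shd)
  next
    case False
    then have s: "?s > 0" by (rule sqnorm_pos)
    define b i where "b = beta x" and "i = inverse (1 + c)"
    have ci: "(1 + c) * i = 1" using c by (simp add: i_def)
    have dc: "(chc has_real_derivative b / 2) (at ?s)"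
      using chc_derivative[OF s] by (simp add: b_def beta_def)
    have dsh: "(shc has_real_derivative (c - b) / (2 * ?s)) (at ?s)"
      using shc_derivative[OF s] by (simp add: b_def beta_def c_def)
    have di: "((\<lambda>t. inverse (1 + chc t)) has_real_derivative - (b / 2) * (i * i)) (at ?s)"
      using DERIV_inverse_fun[OF DERIV_add[OF DERIV_const[of 1] dc]] c
      by (simp add: c_def i_def mult_ac)
    have dxi: "((\<lambda>t. (chc t - 1) * inverse (1 + chc t)) has_real_derivative
        b / 2 * i - (b / 2) * (i * i) * (c - 1)) (at ?s)"
      using DERIV_mult[OF DERIV_diff[OF dc DERIV_const[of 1]] di] by (simp add: c_def i_def)
    have dtau: "((\<lambda>t. shc t * inverse (1 + chc t)) has_real_derivative
        (c - b) / (2 * ?s) * i - (b / 2) * (i * i) * b) (at ?s)"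
      using DERIV_mult[OF dsh di] by (simp add: c_def i_def b_def beta_def)
    have sb: "?s * b * b = c * c - 1"
      using sqnorm_beta[of x] by (simp add: c_def b_def power2_eq_square mult_ac)
    have "bfield xi x = 2 * b * ?s * (b / 2 * i - (b / 2) * (i * i) * (c - 1))"
      using bfield_radial[OF dxi] by (simp add: xi_def[abs_def] b_def)
    also have "\<dots> = ?s * b * b * (i - i * i * (c - 1))"
      by (simp add: field_simps)
    also have "\<dots> = 2 * ((c - 1) * i)"
      unfolding sb using ci by algebra
    finally have 1: "bfield xi x = 2 * xi x" by (simp add: xi_def c_def i_def)
    have "bfield tau x = 2 * b * ?s * ((c - b) / (2 * ?s) * i - (b / 2) * (i * i) * b)"
      using bfield_radial[OF dtau] by (simp add: tau_def[abs_def] beta_def[abs_def] b_def)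
    also have "\<dots> = b * (c - b) * i - ?s * b * b * (i * i) * b"
      using s by (simp add: right_diff_distrib)
    also have "\<dots> = b * i * (1 - b)"
      unfolding sb using ci by algebra
    finally have 2: "bfield tau x = tau x * (1 - beta x)" by (simp add: tau_def c_def i_def b_def)
    have "rotat xi x = 0" "rotat tau x = 0"
      using rotat_radial[OF dxi] rotat_radial[OF dtau]
      by (simp_all add: xi_def[abs_def] tau_def[abs_def] beta_def[abs_def])
    with 1 2 show ?thesis by blast
  qed
  then show "bfield xi x = 2 * xi x" "rotat xi x = 0"
    "bfield tau x = tau x * (1 - beta x)" "rotat tau x = 0" by blast+
qed

text \<open>The harmonic function \<open>tanh (r/2) ^ m * cos (m * theta)\<close>.\<close>

definition harm :: "nat \<Rightarrow> real ^ 2 \<Rightarrow> real" where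
  "harm m x = hre m x * tau x ^ m"

text \<open>A particular solution of the equation with right-hand side \<open>harm m\<close>, minus
  the harmonic multiple that makes it vanish for |x| = R.\<close>

definition eigfun :: "nat \<Rightarrow> real \<Rightarrow> real ^ 2 \<Rightarrow> real" where
  "eigfun m R x = harm m x * (psi m (xi x) - psi m ((tanh (R / 2))\<^sup>2))"

lemma xi_bounds: "0 \<le> xi x" "xi x < 1"
  by (simp_all add: xi_norm tanh_half_squared_less_1)

lemma smooth_on_harm: "open U \<Longrightarrow> smooth_on U (harm m)"
  unfolding harm_def[abs_def]
  using smooth_on_hre_him by (intro smooth_on_mult smooth_on_power smooth_on_tau) auto

lemma smooth_on_psi_xi: "open U \<Longrightarrow> smooth_on U (\<lambda>x. psi m (xi x))"
  by (rule smooth_on_compose[OF _ smooth_real_on_psi smooth_on_xi])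
     (auto intro: less_le_trans[OF _ xi_bounds(1)] xi_bounds(2))

lemma smooth_on_eigfun: "open U \<Longrightarrow> smooth_on U (eigfun m R)"
  unfolding eigfun_def[abs_def]
  by (intro smooth_on_mult smooth_on_diff smooth_on_harm smooth_on_psi_xi smooth_on_const)

lemma smooth_UNIV_differentiable: "smooth_on UNIV f \<Longrightarrow> f differentiable (at x)"
  using smooth_onD_differentiable by blast

lemma derivation_power:
  assumes "f differentiable (at x)"
  shows "rotat (\<lambda>x. f x ^ n) x = real n * f x ^ (n - 1) * rotat f x"
    and "bfield (\<lambda>x. f x ^ n) x = real n * f x ^ (n - 1) * bfield f x"
  using DERIV_pow[of n "f x"]
  by (simp_all add: derivation_compose[of "\<lambda>t. t ^ n" _ f x, OF _ assms])

lemma derivation_cmult: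
  assumes "f differentiable (at x)"
  shows "rotat (\<lambda>x. c * f x) x = c * rotat f x" "bfield (\<lambda>x. c * f x) x = c * bfield f x"
  using derivation_compose[of "\<lambda>t. c * t" c f x, OF _ assms]
  by (simp_all add: DERIV_cmult_Id)

text \<open>The factor m beta from r^m and the factor m (1 - beta) from the power of
  \<open>tau\<close> add up to m.\<close>

lemma bfield_harm: "bfield (harm m) = (\<lambda>x. real m * harm m x)"
proof
  fix x
  have d: "hre m differentiable (at x)" "tau differentiable (at x)" "(\<lambda>x. tau x ^ m) differentiable (at x)"
    using smooth_on_hre_him smooth_on_tau smooth_on_power[OF open_UNIV smooth_on_tau[OF open_UNIV]]
    by (auto intro!: smooth_UNIV_differentiable)
  have "bfield (harm m) x = hre m x * (real m * tau x ^ (m - 1) * (tau x * (1 - beta x)))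
      + real m * beta x * hre m x * tau x ^ m"
    unfolding harm_def[abs_def] derivation_mult(2)[OF d(1,3)] derivation_power[OF d(2)]
    by (simp add: bfield_tau derivation_hre_him)
  also have "\<dots> = real m * harm m x"
    by (cases m) (simp_all add: harm_def algebra_simps)
  finally show "bfield (harm m) x = real m * harm m x" .
qed

lemma rotat_harm: "rotat (rotat (harm m)) x = - (real m)\<^sup>2 * harm m x"
proof -
  have d: "hre m differentiable (at x)" "him m differentiable (at x)"
    "tau differentiable (at x)" "(\<lambda>x. tau x ^ m) differentiable (at x)" for x
    using smooth_on_hre_him smooth_on_tau smooth_on_power[OF open_UNIV smooth_on_tau[OF open_UNIV]]
    by (auto intro!: smooth_UNIV_differentiable)
  have r: "rotat (\<lambda>x. f x * tau x ^ m) x = rotat f x * tau x ^ m" if "f differentiable (at x)" for f x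
    using that by (simp add: derivation_mult d derivation_power rotat_tau)
  have "rotat (harm m) = (\<lambda>x. (- real m) * (him m x * tau x ^ m))"
    unfolding harm_def[abs_def] by (simp add: fun_eq_iff r d derivation_hre_him)
  moreover have "(\<lambda>x. him m x * tau x ^ m) differentiable (at x)"
    by (intro differentiable_mult d)
  ultimately show ?thesis
    by (simp only: derivation_cmult r d derivation_hre_him harm_def power2_eq_square) simp
qed

text \<open>The polar identity determines the Laplacian only off the center, where sinh^2 r can be
  divided out; continuity and the density of the punctured plane settle the center.\<close>

lemma hyp_laplacian_eqI:
  assumes "smooth_on UNIV u" "continuous_on UNIV w"
    and "\<And>x. bfield (bfield u) x + rotat (rotat u) x = sqnorm x * (beta x)\<^sup>2 * w x"
  shows "hyp_laplacian u x = w x"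
proof -
  have eq: "hyp_laplacian u x = w x" if "x \<noteq> 0" for x
    using hyp_laplacian_eq[OF open_UNIV assms(1), of x] assms(3)[of x] sqnorm_pos[OF that] by simp
  have "closed {x. hyp_laplacian u x = w x}"
    by (intro closed_Collect_eq assms(2) smooth_onD_continuous smooth_on_hyp_laplacian open_UNIV assms(1))
  moreover have "- {0} \<subseteq> {x. hyp_laplacian u x = w x}" using eq by auto
  ultimately have "closure (- {0}) \<subseteq> {x. hyp_laplacian u x = w x}" by (rule closure_minimal[rotated])
  then show ?thesis by (auto simp: closure_complement)
qed

lemma hyp_laplacian_harm: "hyp_laplacian (harm m) x = 0"
proof (rule hyp_laplacian_eqI)
  fix x
  have "harm m differentiable (at x)"
    by (intro smooth_UNIV_differentiable smooth_on_harm open_UNIV)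
  then show "bfield (bfield (harm m)) x + rotat (rotat (harm m)) x = sqnorm x * (beta x)\<^sup>2 * 0"
    unfolding bfield_harm rotat_harm by (simp add: derivation_cmult bfield_harm power2_eq_square)
qed (auto intro: smooth_on_harm)

lemma bfield_eigfun:
  "bfield (eigfun m R) =
    (\<lambda>x. real m * eigfun m R x + harm m x * (psi' m (xi x) * (2 * xi x)))"
proof
  fix x
  let ?k = "psi m ((tanh (R / 2))\<^sup>2)"
  have d: "harm m differentiable (at x)" "xi differentiable (at x)" "(\<lambda>x. psi m (xi x) - ?k) differentiable (at x)"
    by (intro smooth_UNIV_differentiable smooth_on_harm smooth_on_xi smooth_on_diff smooth_on_psi_xi
        smooth_on_const open_UNIV)+
  have D: "((\<lambda>t. psi m t - ?k) has_real_derivative psi' m (xi x)) (at (xi x))"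
    using DERIV_diff[OF psi_derivative(1) DERIV_const] xi_bounds[of x] by simp
  show "bfield (eigfun m R) x =
      real m * eigfun m R x + harm m x * (psi' m (xi x) * (2 * xi x))"
    unfolding eigfun_def[abs_def] derivation_mult(2)[OF d(1,3)]
      derivation_compose(2)[of "\<lambda>t. psi m t - ?k" _ xi, OF D d(2)]
    by (simp add: bfield_harm bfield_xi)
qed

text \<open>Multiplication by \<open>harm m\<close> shifts \<open>bfield\<close> by m, and on
  functions of X = \<open>xi x\<close> the field is 2 X d/dX. The two squares together give 4 X ((m
  + 1) psi' + X psi'') times \<open>harm m\<close>, which \<open>psi_ode\<close> evaluates.\<close>

lemma hyp_laplacian_eigfun: "hyp_laplacian (eigfun m R) x = harm m x"
proof (rule hyp_laplacian_eqI)
  show "smooth_on UNIV (eigfun m R)" "continuous_on UNIV (harm m)"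
    by (intro smooth_on_eigfun smooth_onD_continuous smooth_on_harm open_UNIV)+
  fix x
  let ?k = "psi m ((tanh (R / 2))\<^sup>2)"
  define X c where "X = xi x" and "c = chc (sqnorm x)"
  have X: "\<bar>X\<bar> < 1" using xi_bounds[of x] by (simp add: X_def)
  have d: "harm m differentiable (at x)" "xi differentiable (at x)" "eigfun m R differentiable (at x)"
    "(\<lambda>x. psi m (xi x) - ?k) differentiable (at x)" for x
    by (intro smooth_UNIV_differentiable smooth_on_harm smooth_on_xi smooth_on_eigfun smooth_on_diff
        smooth_on_psi_xi smooth_on_const open_UNIV)+
  have dX: "((\<lambda>t. psi' m t * (2 * t)) has_real_derivative psi'' m X * (2 * X) + 2 * psi' m X) (at (xi x))"
    using DERIV_mult[OF psi_derivative(2)[OF X] DERIV_cmult_Id[of 2]] by (simp add: X_def mult_ac)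
  have dG: "(\<lambda>x. psi' m (xi x) * (2 * xi x)) differentiable (at x)"
    using compose_has_derivative[of "\<lambda>t. psi' m t * (2 * t)" _ xi, OF dX d(2)] differentiableI by blast
  have "bfield (bfield (eigfun m R)) x = real m * bfield (eigfun m R) x +
      (harm m x * ((psi'' m X * (2 * X) + 2 * psi' m X) * (2 * X)) +
        real m * harm m x * (psi' m X * (2 * X)))"
  proof -
    have "bfield (\<lambda>x. f x + g x) x = bfield f x + bfield g x"
      if "f differentiable (at x)" "g differentiable (at x)" for f g
      using that by (simp add: bfield_def euler_def partial_deriv_add algebra_simps)
    note add = this
    have "bfield (\<lambda>x. psi' m (xi x) * (2 * xi x)) x = (psi'' m X * (2 * X) + 2 * psi' m X) * (2 * X)"
      using derivation_compose(2)[of "\<lambda>t. psi' m t * (2 * t)" _ xi, OF dX d(2)]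
      by (simp add: bfield_xi X_def)
    then show ?thesis
      by (subst (1) bfield_eigfun)
         (simp add: add derivation_cmult derivation_mult(2) d dG bfield_harm X_def del: mult.assoc)
  qed
  moreover have "rotat (rotat (eigfun m R)) x = - (real m)\<^sup>2 * eigfun m R x"
  proof -
    have D: "((\<lambda>t. psi m t - ?k) has_real_derivative psi' m (xi x)) (at (xi x))" for x
      using DERIV_diff[OF psi_derivative(1) DERIV_const] xi_bounds[of x] by simp
    have r: "rotat (\<lambda>x. psi m (xi x) - ?k) x = 0" for x
      using derivation_compose(1)[of "\<lambda>t. psi m t - ?k" _ xi, OF D d(2)] by (simp add: rotat_xi)
    have dr: "rotat (harm m) differentiable (at x)" for x
      by (intro smooth_UNIV_differentiable smooth_on_rotat smooth_on_harm open_UNIV)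
    have "rotat (eigfun m R) = (\<lambda>x. rotat (harm m) x * (psi m (xi x) - ?k))"
      unfolding eigfun_def[abs_def] by (simp add: fun_eq_iff derivation_mult(1) d r)
    then show ?thesis
      by (simp add: derivation_mult(1) d dr r rotat_harm eigfun_def)
  qed
  ultimately have "bfield (bfield (eigfun m R)) x + rotat (rotat (eigfun m R)) x =
      4 * X * harm m x * ((real m + 1) * psi' m X + X * psi'' m X)"
    by (simp add: bfield_eigfun X_def power2_eq_square algebra_simps)
  also have "\<dots> = 4 * X / (1 - X)\<^sup>2 * harm m x"
    unfolding psi_ode[OF X] by simp
  \<comment> \<open>With c = cosh r one has 1 - X = 2 / (c + 1), so the left side is (c - 1)(c + 1),
    exactly the factor sinh^2 r of the polar identity.\<close>
  also have "4 * X / (1 - X)\<^sup>2 = sqnorm x * (beta x)\<^sup>2"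
  proof -
    define i where "i = inverse (1 + c)"
    have "1 + c > 0" using chc_ge_1[of "sqnorm x"] by (simp add: c_def)
    then have ci: "(1 + c) * i = 1" by (simp add: i_def)
    have Xi: "X = (c - 1) * i" by (simp add: X_def xi_def c_def i_def)
    have "4 * X = (c * c - 1) * (1 - X)\<^sup>2"
      unfolding Xi using ci by algebra
    then show ?thesis
      unfolding sqnorm_beta c_def[symmetric] using X by (simp add: divide_simps power2_eq_square)
  qed
  finally show "bfield (bfield (eigfun m R)) x + rotat (rotat (eigfun m R)) x =
      sqnorm x * (beta x)\<^sup>2 * harm m x" .
qed

text \<open>The unit radial derivative is r d/dr divided by r, and sinh r = r beta turns this into
  \<open>bfield\<close> divided by sinh r.\<close>

lemma frechet_derivative_outward_normal:
  assumes "u differentiable (at x)" "x \<noteq> 0"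
  shows "frechet_derivative u (at x) (outward_normal x) = bfield u x / sinh (norm x)"
proof -
  interpret bounded_linear "frechet_derivative u (at x)"
    using assms(1) by (simp add: frechet_derivative_works has_derivative_bounded_linear)
  have "outward_normal x = inverse (norm x) *\<^sub>R (x $ 1 *\<^sub>R axis 1 1 + x $ 2 *\<^sub>R axis 2 1)"
    by (simp add: outward_normal_def vec_eq_iff forall_2 axis_def)
  then have "frechet_derivative u (at x) (outward_normal x) = inverse (norm x) * euler u x"
    by (simp add: scaleR add euler_def partial_deriv_def)
  then show ?thesis
    using assms(2) by (simp add: sinh_norm bfield_def divide_simps)
qed

definition eta :: "nat \<Rightarrow> real \<Rightarrow> real" where
  "eta m R = sinh R * tanh (R / 2) ^ (2 * m) / F m R"

lemma steklov2_eigenvalue_eta: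
  assumes R: "R > 0"
  shows "steklov2_eigenvalue R (eta m R)"
  unfolding steklov2_eigenvalue_def
proof (intro exI conjI ballI)
  show "smooth_on UNIV (eigfun m R)" by (rule smooth_on_eigfun) simp
  define y :: "real ^ 2" where "y = (R / 2) *\<^sub>R axis 1 1"
  have y: "norm y = R / 2" using R by (simp add: y_def norm_axis_1)
  show "\<exists>x\<in>cball 0 R. eigfun m R x \<noteq> 0"
  proof (rule ccontr)
    \<comment> \<open>A function vanishing on the disk has Laplacian 0 inside; but the Laplacian is
      \<open>harm m\<close>, which is positive on the half-axis theta = 0 that contains
      \<open>y\<close>.\<close>
    assume "\<not> (\<exists>x\<in>cball 0 R. eigfun m R x \<noteq> 0)"
    then have *: "eigfun m R x = 0" if "x \<in> ball 0 R" for x using that by auto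
    have zero: "bfield (\<lambda>x. 0) = (\<lambda>x. 0)" "rotat (\<lambda>x. 0) = (\<lambda>x. 0)"
      by (simp_all add: fun_eq_iff bfield_def rotat_def euler_def)
    have "hyp_laplacian (eigfun m R) y = hyp_laplacian (\<lambda>x. 0) y"
      by (rule hyp_laplacian_cong[of "ball 0 R"]) (use R y * in auto)
    also have "\<dots> = 0"
      by (rule hyp_laplacian_eqI[where w = "\<lambda>x. 0"])
         (auto simp: smooth_on_const zero)
    finally have "harm m y = 0" by (simp add: hyp_laplacian_eigfun)
    moreover have "harm m y > 0"
      using R hre_axis[of m "R / 2"] tau_pos[of y] by (simp add: harm_def y_def)
    ultimately show False by simp
  qed
  show "hyp_laplacian (hyp_laplacian (eigfun m R)) x = 0" for x
  proof -
    have "hyp_laplacian (eigfun m R) = harm m" by (simp add: fun_eq_iff hyp_laplacian_eigfun)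
    then show ?thesis by (simp add: hyp_laplacian_harm)
  qed
  fix x :: "real ^ 2" assume x: "x \<in> sphere 0 R"
  then have n: "norm x = R" "x \<noteq> 0" using R by auto
  show u0: "eigfun m R x = 0" by (simp add: eigfun_def xi_norm n)
  have "eigfun m R differentiable (at x)"
    by (intro smooth_UNIV_differentiable smooth_on_eigfun open_UNIV)
  note normal = frechet_derivative_outward_normal[OF this n(2)]
  \<comment> \<open>\<open>bfield\<close> of the psi factor on the boundary. As the eigenfunction
    vanishes there, its normal derivative is \<open>harm m\<close> times G / sinh R, so the
    eigenvalue is sinh R / G.\<close>
  define G where "G = psi' m ((tanh (R / 2))\<^sup>2) * (2 * (tanh (R / 2))\<^sup>2)"
  then have D: "frechet_derivative (eigfun m R) (at x) (outward_normal x) = harm m x * G / sinh R"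
    by (simp add: normal bfield_eigfun u0 xi_norm n)
  have G: "F m R = tanh (R / 2) ^ (2 * m) * G"
    by (simp add: F_def G_def power2_eq_square mult_ac)
  have "F m R \<noteq> 0" "sinh R \<noteq> 0" using F_pos[of R m] R by auto
  then show "hyp_laplacian (eigfun m R) x =
      eta m R * frechet_derivative (eigfun m R) (at x) (outward_normal x)"
    unfolding hyp_laplacian_eigfun eta_def D by (simp add: G)
qed auto

section \<open>Fourier coefficients on circles\<close>

definition polar :: "real \<Rightarrow> real \<Rightarrow> real ^ 2" where
  "polar r t = (r * cos t) *\<^sub>R axis 1 1 + (r * sin t) *\<^sub>R axis 2 1"

lemma polar_component [simp]: "polar r t $ 1 = r * cos t" "polar r t $ 2 = r * sin t"
  by (simp_all add: polar_def axis_def)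

lemma sqnorm_polar [simp]: "sqnorm (polar r t) = r\<^sup>2"
  by (simp add: sqnorm_def power_mult_distrib flip: distrib_left)

lemma norm_polar [simp]: "norm (polar r t) = \<bar>r\<bar>"
proof -
  have "sqrt ((norm (polar r t))\<^sup>2) = sqrt (r\<^sup>2)"
    using sqnorm_polar[of r t] unfolding sqnorm_eq by simp
  then show ?thesis by simp
qed

lemma polar_surj:
  obtains t where "t \<in> {0..2 * pi}" "x = polar (norm x) t"
proof (cases "x = 0")
  case True
  show ?thesis by (rule that[of 0]) (use True in \<open>simp_all add: polar_def\<close>)
next
  case False
  have "(x $ 1 / norm x)\<^sup>2 + (x $ 2 / norm x)\<^sup>2 = sqnorm x / (norm x)\<^sup>2"
    by (simp add: sqnorm_def power_divide add_divide_distrib)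
  also have "\<dots> = 1" using False by (simp add: sqnorm_eq)
  finally obtain t where t: "0 \<le> t" "t < 2 * pi" "x $ 1 / norm x = cos t" "x $ 2 / norm x = sin t"
    using sincos_total_2pi by blast
  have "x = polar (norm x) t"
    unfolding vec_eq_iff forall_2 polar_component t(3,4)[symmetric] using False by simp
  then show ?thesis using t(1,2) by (intro that[of t]) simp_all
qed

lemma continuous_on_polar [continuous_intros]:
  fixes S :: "'a::t2_space set"
  assumes "continuous_on S a" "continuous_on S b"
  shows "continuous_on S (\<lambda>z. polar (a z) (b z))"
  unfolding polar_def by (intro continuous_intros assms)

text \<open>Integer frequencies and free phases keep the family closed under products with cos (t +
  e): the frequencies k + 1 and k - 1 call for no case distinction, and the phases cover the
  sines.\<close>

definition orth :: "(real \<Rightarrow> real) \<Rightarrow> bool" where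
  "orth v \<longleftrightarrow> (\<forall>k::int. \<forall>d. ((\<lambda>t. v t * cos (of_int k * t + d)) has_integral 0) {0..2 * pi})"

lemma orth_add: "orth v \<Longrightarrow> orth w \<Longrightarrow> orth (\<lambda>t. v t + w t)"
  unfolding orth_def distrib_right
proof (intro allI)
  fix k :: int and d :: real
  assume "\<forall>k d. ((\<lambda>t. v t * cos (real_of_int k * t + d)) has_integral 0) {0..2 * pi}"
    "\<forall>k d. ((\<lambda>t. w t * cos (real_of_int k * t + d)) has_integral 0) {0..2 * pi}"
  then have "((\<lambda>t. v t * cos (real_of_int k * t + d)) has_integral 0) {0..2 * pi}"
    "((\<lambda>t. w t * cos (real_of_int k * t + d)) has_integral 0) {0..2 * pi}" by blast+
  from has_integral_add[OF this]
  show "((\<lambda>t. v t * cos (real_of_int k * t + d) + w t * cos (real_of_int k * t + d))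
      has_integral 0) {0..2 * pi}" by simp
qed

lemma orth_mult_const: "orth v \<Longrightarrow> orth (\<lambda>t. v t * c)"
  unfolding orth_def
proof (intro allI)
  fix k :: int and d :: real
  assume "\<forall>k d. ((\<lambda>t. v t * cos (real_of_int k * t + d)) has_integral 0) {0..2 * pi}"
  then have "((\<lambda>t. v t * cos (real_of_int k * t + d)) has_integral 0) {0..2 * pi}" by blast
  from has_integral_mult_right[OF this, of c]
  show "((\<lambda>t. v t * c * cos (real_of_int k * t + d)) has_integral 0) {0..2 * pi}"
    by (simp add: mult_ac)
qed

lemma orth_mult_cos:
  assumes "orth v"
  shows "orth (\<lambda>t. v t * cos (t + e))"
  unfolding orth_def
proof (intro allI)
  fix k :: int and d :: real
  have "((\<lambda>t. v t * cos (of_int (k + 1) * t + (d + e)) + v t * cos (of_int (k - 1) * t + (d - e)))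
      has_integral 0 + 0) {0..2 * pi}"
    using assms unfolding orth_def by (intro has_integral_add) blast+
  from has_integral_mult_right[OF this, of "1 / 2"]
  have "((\<lambda>t. 1 / 2 * (v t * cos (of_int (k + 1) * t + (d + e)) + v t * cos (of_int (k - 1) * t + (d - e))))
      has_integral 0) {0..2 * pi}" by simp
  also have "(\<lambda>t. 1 / 2 * (v t * cos (of_int (k + 1) * t + (d + e)) + v t * cos (of_int (k - 1) * t + (d - e))))
      = (\<lambda>t. v t * cos (t + e) * cos (of_int k * t + d))"
  proof
    fix t
    have "cos (of_int (k + 1) * t + (d + e)) + cos (of_int (k - 1) * t + (d - e)) =
        cos ((of_int k * t + d) + (t + e)) + cos ((of_int k * t + d) - (t + e))"
      by (simp add: algebra_simps)
    also have "\<dots> = 2 * (cos (t + e) * cos (of_int k * t + d))"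
      by (simp only: cos_add[of "of_int k * t + d"] cos_diff) (simp add: mult_ac)
    finally show "1 / 2 * (v t * cos (of_int (k + 1) * t + (d + e)) + v t * cos (of_int (k - 1) * t + (d - e)))
      = v t * cos (t + e) * cos (of_int k * t + d)"
      by (simp flip: distrib_left)
  qed
  finally show "((\<lambda>t. v t * cos (t + e) * cos (of_int k * t + d)) has_integral 0) {0..2 * pi}" .
qed

text \<open>The function \<open>v\<close> stays arbitrary in the induction, so that a product of
  polynomials is absorbed by two successive multiplications.\<close>

lemma orth_mult_polynomial:
  assumes "real_polynomial_function p" "orth v"
  shows "orth (\<lambda>t. v t * p (polar r t))"
  using assms
proof (induction arbitrary: v rule: real_polynomial_function.induct)
  case (linear f)
  interpret bounded_linear f by fact
  \<comment> \<open>On a circle both coordinates are shifted cosines, as sin t = cos (t -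
    pi/2).\<close>
  have "f (polar r t) = cos (t + 0) * (r * f (axis 1 1)) + cos (t + - (pi / 2)) * (r * f (axis 2 1))" for t
    by (simp add: polar_def add scaleR cos_diff)
  then have "(\<lambda>t. v t * f (polar r t)) = (\<lambda>t. v t * cos (t + 0) * (r * f (axis 1 1)) +
      v t * cos (t + - (pi / 2)) * (r * f (axis 2 1)))"
    by (simp add: fun_eq_iff distrib_left mult.assoc)
  then show ?case
    using linear.prems by (simp only:) (intro orth_add orth_mult_const orth_mult_cos)
next
  case (const c)
  then show ?case by (rule orth_mult_const)
next
  case (add f g)
  then show ?case using orth_add[OF add.IH(1) add.IH(2)] by (simp add: distrib_left)
next
  case (mult f g)
  then show ?case using mult.IH(2)[OF mult.IH(1)] by (simp add: mult.assoc)
qed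

text \<open>The phase \<open>d\<close> covers cosine and sine coefficients at once; the integral is
  left unnormalized, since only its vanishing and linear equations for it matter.\<close>

definition fourier :: "nat \<Rightarrow> real \<Rightarrow> (real ^ 2 \<Rightarrow> real) \<Rightarrow> real \<Rightarrow> real" where
  "fourier m d f r = integral {0..2 * pi} (\<lambda>t. f (polar r t) * cos (real m * t + d))"

lemma continuous_on_circle:
  "continuous_on (sphere 0 r) f \<Longrightarrow> r \<ge> 0 \<Longrightarrow> continuous_on S (\<lambda>t. f (polar r t))"
  by (rule continuous_on_compose2[of "sphere 0 r" f]) (auto intro!: continuous_intros)

text \<open>On the circle, v is orthogonal to every polynomial p. Choosing p with |v - p| < e by
  Stone-Weierstrass bounds the integral of v^2 by e times the integral of |v|.\<close>

lemma fourier_complete: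
  assumes f: "continuous_on (sphere 0 r) f" and r: "r \<ge> 0"
    and zero: "\<And>m d. fourier m d f r = 0" and x: "x \<in> sphere 0 r"
  shows "f x = 0"
proof -
  define v where "v = (\<lambda>t. f (polar r t))"
  have v: "continuous_on {0..2 * pi} v"
    unfolding v_def by (rule continuous_on_circle[OF f r])
  have "orth v"
    unfolding orth_def
  proof (intro allI)
    fix k :: int and d :: real
    \<comment> \<open>The cosine is even, so a negative frequency is reflected at the price of the
      opposite phase.\<close>
    define m e where "m = nat \<bar>k\<bar>" and "e = (if k < 0 then - d else d)"
    have "cos (real m * t + e) = cos (of_int k * t + d)" for t
    proof (cases "k < 0")
      case True
      then have "real m * t + e = - (of_int k * t + d)" by (simp add: m_def e_def)
      then show ?thesis by (metis cos_minus)
    qed (simp add: m_def e_def)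
    moreover have "(\<lambda>t. v t * cos (real m * t + e)) integrable_on {0..2 * pi}"
      by (intro integrable_continuous_real continuous_intros v)
    ultimately show "((\<lambda>t. v t * cos (of_int k * t + d)) has_integral 0) {0..2 * pi}"
      using zero[of m e] unfolding fourier_def v_def[symmetric]
      by (simp add: has_integral_integral[symmetric] has_integral_iff v_def)
  qed
  have int: "g integrable_on {0..2 * pi}" if "continuous_on {0..2 * pi} g" for g :: "real \<Rightarrow> real"
    using that by (rule integrable_continuous_real)
  have bound: "integral {0..2 * pi} (\<lambda>t. v t * v t) \<le> e * integral {0..2 * pi} (\<lambda>t. \<bar>v t\<bar>)"
    if e: "e > 0" for e
  proof -
    obtain p where p: "real_polynomial_function p" "\<And>x. x \<in> sphere 0 r \<Longrightarrow> \<bar>f x - p x\<bar> < e"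
      using Stone_Weierstrass_real_polynomial_function[OF compact_sphere f e] by metis
    have pc: "continuous_on {0..2 * pi} (\<lambda>t. p (polar r t))"
      by (rule continuous_on_circle[OF _ r])
         (meson p(1) continuous_on_polymonial_function real_polynomial_function_eq)
    have "((\<lambda>t. v t * p (polar r t) * cos (of_int 0 * t + 0)) has_integral 0) {0..2 * pi}"
      using orth_mult_polynomial[OF p(1) \<open>orth v\<close>, of r] unfolding orth_def by blast
    then have "integral {0..2 * pi} (\<lambda>t. v t * p (polar r t)) = 0"
      by (simp add: integral_unique)
    then have "integral {0..2 * pi} (\<lambda>t. v t * v t) =
        integral {0..2 * pi} (\<lambda>t. v t * v t - v t * p (polar r t))"
      by (subst integral_diff) (auto intro!: int continuous_intros v pc)
    also have "\<dots> \<le> integral {0..2 * pi} (\<lambda>t. e * \<bar>v t\<bar>)"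
    proof (rule integral_le)
      fix t
      have "v t * v t - v t * p (polar r t) \<le> \<bar>v t * (v t - p (polar r t))\<bar>"
        by (simp add: right_diff_distrib)
      also have "\<dots> = \<bar>v t\<bar> * \<bar>v t - p (polar r t)\<bar>" by (rule abs_mult)
      also have "\<dots> \<le> \<bar>v t\<bar> * e"
        using p(2)[of "polar r t"] r by (intro mult_left_mono) (auto simp: v_def)
      finally show "v t * v t - v t * p (polar r t) \<le> e * \<bar>v t\<bar>" by (simp add: mult.commute)
    qed (auto intro!: int continuous_intros v pc)
    finally show ?thesis by simp
  qed
  have "integral {0..2 * pi} (\<lambda>t. v t * v t) \<le> 0"
  proof (rule field_le_epsilon)
    fix e :: real assume e: "e > 0"
    define I where "I = integral {0..2 * pi} (\<lambda>t. \<bar>v t\<bar>)"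
    have "I \<ge> 0" unfolding I_def by (intro integral_nonneg int continuous_intros v) auto
    \<comment> \<open>The summand 1 keeps the denominator positive when \<open>I\<close> is
      0.\<close>
    then have "e / (I + 1) * I \<le> e" using e by (simp add: divide_simps)
    then show "integral {0..2 * pi} (\<lambda>t. v t * v t) \<le> 0 + e"
      using bound[of "e / (I + 1)"] e \<open>I \<ge> 0\<close> by (simp add: I_def)
  qed
  moreover have "integral {0..2 * pi} (\<lambda>t. v t * v t) \<ge> 0"
    by (intro integral_nonneg int continuous_intros v) auto
  ultimately have "integral {0..2 * pi} (\<lambda>t. v t * v t) = 0" by linarith
  then have v0: "\<forall>t\<in>{0..2 * pi}. v t * v t = 0"
    by (subst (asm) integral_eq_0_iff) (intro continuous_intros v | simp)+
  obtain t where "t \<in> {0..2 * pi}" "x = polar (norm x) t" by (rule polar_surj)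
  then show ?thesis using v0 x by (auto simp: v_def)
qed

section \<open>Differential equations for the Fourier coefficients\<close>

lemma has_real_derivative_along_curve:
  fixes f :: "real ^ 2 \<Rightarrow> real"
  assumes "f differentiable (at (a t *\<^sub>R axis 1 1 + b t *\<^sub>R axis 2 1))" (is "_ differentiable (at ?x)")
    and a: "(a has_real_derivative a') (at t within S)"
    and b: "(b has_real_derivative b') (at t within S)"
  shows "((\<lambda>t. f (a t *\<^sub>R axis 1 1 + b t *\<^sub>R axis 2 1)) has_real_derivative
    a' * partial_deriv 1 f ?x + b' * partial_deriv 2 f ?x) (at t within S)"
proof -
  interpret f: bounded_linear "frechet_derivative f (at ?x)"
    using assms(1) by (simp add: frechet_derivative_works has_derivative_bounded_linear)
  have "((\<lambda>t. a t *\<^sub>R axis 1 1 + b t *\<^sub>R axis 2 1 :: real ^ 2) has_derivative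
      (\<lambda>h. (a' * h) *\<^sub>R axis 1 1 + (b' * h) *\<^sub>R axis 2 1)) (at t within S)"
    by (intro has_derivative_add has_derivative_scaleR_left a[unfolded has_field_derivative_def]
        b[unfolded has_field_derivative_def])
  from has_derivative_compose[OF this, of f] assms(1)
  have "((\<lambda>t. f (a t *\<^sub>R axis 1 1 + b t *\<^sub>R axis 2 1)) has_derivative
      (\<lambda>h. frechet_derivative f (at ?x) ((a' * h) *\<^sub>R axis 1 1 + (b' * h) *\<^sub>R axis 2 1)))
      (at t within S)"
    by (simp add: frechet_derivative_works)
  moreover have "(\<lambda>h. frechet_derivative f (at ?x) ((a' * h) *\<^sub>R axis 1 1 + (b' * h) *\<^sub>R axis 2 1)) =
      (*) (a' * partial_deriv 1 f ?x + b' * partial_deriv 2 f ?x)"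
    by (simp add: fun_eq_iff f.add f.scaleR partial_deriv_def algebra_simps)
  ultimately show ?thesis by (simp add: has_field_derivative_def)
qed

text \<open>Differentiation under the integral sign works on all of \<open>{0..R}\<close>, because
  \<open>f\<close> is smooth beyond the closed disk; continuity up to both endpoints comes with it.
  Multiplying the radial derivative by sinh r turns it into \<open>bfield\<close>.\<close>

lemma
  assumes U: "open U" "cball 0 R \<subseteq> U" and f: "smooth_on U f"
  shows fourier_continuous: "continuous_on {0..R} (fourier m d f)"
    and fourier_derivative: "\<And>r. r \<in> {0<..<R} \<Longrightarrow>
      (fourier m d f has_real_derivative fourier m d (bfield f) r / sinh r) (at r)"
proof -
  define D where "D = (\<lambda>r t. (cos t * partial_deriv 1 f (polar r t) +
      sin t * partial_deriv 2 f (polar r t)) * cos (real m * t + d))"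
  have sub: "polar r t \<in> U" if "r \<in> {0..R}" for r t
    using that U(2) by (auto simp: subset_iff)
  have cont: "continuous_on S (\<lambda>z. g (polar (a z) (b z)))"
    if "smooth_on U g" "continuous_on S a" "continuous_on S b" "\<And>z. z \<in> S \<Longrightarrow> a z \<in> {0..R}"
    for g a b and S :: "'a::t2_space set"
    using that sub
    by (intro continuous_on_compose2[OF smooth_onD_continuous[OF that(1)]] continuous_intros) auto
  have cbox: "integral {0..2 * pi} g = integral (cbox 0 (2 * pi)) g" for g :: "real \<Rightarrow> real" by simp
  have der: "(fourier m d f has_real_derivative integral {0..2 * pi} (D r)) (at r within {0..R})"
    if r: "r \<in> {0..R}" for r
    unfolding fourier_def[abs_def] cbox
  proof (rule leibniz_rule_field_derivative)
    fix x t assume x: "x \<in> {0..R}" and t: "t \<in> cbox 0 (2 * pi)"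
    have "((\<lambda>r. f (polar r t)) has_real_derivative
        cos t * partial_deriv 1 f (polar x t) + sin t * partial_deriv 2 f (polar x t)) (at x within {0..R})"
      unfolding polar_def
      by (rule has_real_derivative_along_curve)
         (use smooth_onD_differentiable[OF f sub[OF x]] in
          \<open>auto simp: polar_def intro!: derivative_eq_intros\<close>)
    then show "((\<lambda>r. f (polar r t) * cos (real m * t + d)) has_real_derivative D x t) (at x within {0..R})"
      unfolding D_def by (rule DERIV_cmult_right)
  next
    fix x assume "x \<in> {0..R}"
    then show "(\<lambda>t. f (polar x t) * cos (real m * t + d)) integrable_on cbox 0 (2 * pi)"
      unfolding cbox_interval
      by (intro integrable_continuous_real continuous_intros cont f) auto
  next
    show "continuous_on ({0..R} \<times> cbox 0 (2 * pi)) (\<lambda>(x, t). D x t)"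
      unfolding D_def split_beta
      by (intro continuous_intros cont smooth_on_partial_deriv f) auto
  qed (use r in auto)
  show "continuous_on {0..R} (fourier m d f)"
    using der DERIV_continuous continuous_on_eq_continuous_within by blast
  show "(fourier m d f has_real_derivative fourier m d (bfield f) r / sinh r) (at r)"
    if r: "r \<in> {0<..<R}" for r
  proof -
    have "sinh r * D r t = bfield f (polar r t) * cos (real m * t + d)" for t
      by (simp add: D_def bfield_def beta_def euler_def sinh_eq_shc algebra_simps)
    then have "sinh r * integral {0..2 * pi} (D r) = fourier m d (bfield f) r"
      unfolding fourier_def by (simp flip: integral_mult_right)
    then have "integral {0..2 * pi} (D r) = fourier m d (bfield f) r / sinh r"
      using r by (simp add: field_simps)
    moreover have "at r within {0..R} = at r"
      using r by (intro at_within_interior) simp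
    ultimately show ?thesis using der[of r] r by simp
  qed
qed

text \<open>Integration by parts over a full period, where the boundary terms cancel. The derivative
  of the cosine is written with the phase d - pi/2, so the result is again a coefficient of the same
  family.\<close>

lemma fourier_rotat:
  assumes U: "open U" "cball 0 R \<subseteq> U" and f: "smooth_on U f" and r: "r \<in> {0..R}"
  shows "fourier m d (rotat f) r = real m * fourier m (d - pi / 2) f r"
proof -
  have sub: "polar r t \<in> U" for t
    using r U(2) by (auto simp: subset_iff)
  have cont: "continuous_on {0..2 * pi} (\<lambda>t. g (polar r t))" if "smooth_on U g" for g
    using sub
    by (intro continuous_on_compose2[OF smooth_onD_continuous[OF that]] continuous_intros) auto
  let ?c = "\<lambda>t. cos (real m * t + d)"
  have "((\<lambda>t. rotat f (polar r t) * ?c t - real m * (f (polar r t) * cos (real m * t + (d - pi / 2))))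
      has_integral f (polar r (2 * pi)) * ?c (2 * pi) - f (polar r 0) * ?c 0) {0..2 * pi}"
  proof (rule fundamental_theorem_of_calculus)
    fix t :: real
    have "((\<lambda>t. f (polar r t)) has_real_derivative
        - (r * sin t) * partial_deriv 1 f (polar r t) + r * cos t * partial_deriv 2 f (polar r t))
        (at t within {0..2 * pi})"
      unfolding polar_def
      by (rule has_real_derivative_along_curve)
         (use smooth_onD_differentiable[OF f sub[of t]] in
          \<open>auto simp: polar_def intro!: derivative_eq_intros\<close>)
    also have "- (r * sin t) * partial_deriv 1 f (polar r t) + r * cos t * partial_deriv 2 f (polar r t)
        = rotat f (polar r t)" by (simp add: rotat_def)
    finally have 1: "((\<lambda>t. f (polar r t)) has_real_derivative rotat f (polar r t)) (at t within {0..2 * pi})" .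
    have 2: "(?c has_real_derivative - real m * cos (real m * t + (d - pi / 2))) (at t within {0..2 * pi})"
      by (auto intro!: derivative_eq_intros simp: cos_add cos_diff sin_add sin_diff algebra_simps)
    show "((\<lambda>t. f (polar r t) * ?c t) has_vector_derivative rotat f (polar r t) * ?c t -
        real m * (f (polar r t) * cos (real m * t + (d - pi / 2)))) (at t within {0..2 * pi})"
      using DERIV_mult[OF 1 2]
      by (simp add: has_real_derivative_iff_has_vector_derivative mult_ac)
  qed simp
  moreover have "polar r (2 * pi) = polar r 0" by (simp add: polar_def)
  moreover have "?c (2 * pi) = ?c 0"
    using cos_eq_periodic_intro[of "real m * (2 * pi) + d" d m] by (simp add: mult_ac)
  ultimately have "integral {0..2 * pi} (\<lambda>t. rotat f (polar r t) * ?c t -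
      real m * (f (polar r t) * cos (real m * t + (d - pi / 2)))) = 0"
    by (simp add: integral_unique)
  then show ?thesis
    unfolding fourier_def
    by (subst (asm) integral_diff)
       (auto intro!: integrable_continuous_real continuous_intros cont smooth_on_rotat U f)
qed

lemma fourier_rotat_rotat:
  assumes U: "open U" "cball 0 R \<subseteq> U" and f: "smooth_on U f" and r: "r \<in> {0..R}"
  shows "fourier m d (rotat (rotat f)) r = - (real m)\<^sup>2 * fourier m d f r"
proof -
  have "fourier m d (rotat (rotat f)) r = real m * (real m * fourier m (d - pi / 2 - pi / 2) f r)"
    by (simp only: fourier_rotat[OF U smooth_on_rotat[OF U(1) f] r] fourier_rotat[OF U f r])
  moreover have "cos (real m * t + (d - pi / 2 - pi / 2)) = - cos (real m * t + d)" for t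
    using cos_minus_pi[of "real m * t + d"] by (simp add: algebra_simps)
  ultimately show ?thesis by (simp add: fourier_def power2_eq_square)
qed

section \<open>Completeness of the spectrum\<close>

text \<open>Says that T^m solves sinh r y' = m y: it is the regular solution and also the
  integrating factor in what follows.\<close>

lemma tanh_half_power_derivative:
  assumes "r > 0"
  shows "((\<lambda>r. tanh (r / 2 :: real) ^ m) has_real_derivative real m * tanh (r / 2) ^ m / sinh r) (at r)"
proof -
  have c: "1 + cosh r \<noteq> 0" "sinh r \<noteq> 0" using cosh_real_pos[of r] assms by (linarith, simp)
  have "1 / (1 + cosh r) = tanh (r / 2) / sinh r"
    using c by (simp add: tanh_half)
  then show ?thesis
    using DERIV_power[OF tanh_half_derivative[of r], of m] by (cases m) (simp_all add: mult_ac)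
qed

text \<open>With B = sinh r d/dr and q = B y, the equation reads (B + m)(B - m) y = c sinh^2 r T^m.
  Multiplied by T^m, its left side is B applied to T^m (q - m y) and its right side is B applied to
  c \<open>F m\<close>, so the two differ by a constant.\<close>

lemma radial_ode:
  fixes y q :: "real \<Rightarrow> real"
  assumes R: "R > 0" and cont: "continuous_on {0..R} y" "continuous_on {0..R} q" and q0: "q 0 = 0"
    and y: "\<And>r. r \<in> {0<..<R} \<Longrightarrow> (y has_real_derivative q r / sinh r) (at r)"
    and q: "\<And>r. r \<in> {0<..<R} \<Longrightarrow>
      (q has_real_derivative ((real m)\<^sup>2 * y r + c * (sinh r)\<^sup>2 * tanh (r / 2) ^ m) / sinh r) (at r)"
    and r: "r \<in> {0..R}"
  shows "tanh (r / 2) ^ m * (q r - real m * y r) = c * F m r"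
proof -
  define P where "P = (\<lambda>r. tanh (r / 2) ^ m * (q r - real m * y r) - c * F m r)"
  have "P r = P 0"
  proof (rule DERIV_isconst2[OF R])
    show "continuous_on {0..R} P"
      unfolding P_def
      by (intro continuous_intros cont continuous_at_imp_continuous_on ballI DERIV_isCont[OF F_derivative]) auto
  next
    fix x assume x: "0 < x" "x < R"
    define S T where "S = sinh x" and "T = tanh (x / 2) ^ m"
    have S: "S \<noteq> 0" using x by (simp add: S_def)
    have "(P has_real_derivative
        real m * T / S * (q x - real m * y x) +
        (((real m)\<^sup>2 * y x + c * S\<^sup>2 * T) / S - real m * (q x / S)) * T - c * (tanh (x / 2) ^ (2 * m) * S)) (at x)"
      unfolding P_def S_def T_def using x
      by (intro DERIV_diff DERIV_mult DERIV_cmult tanh_half_power_derivative F_derivative y q) auto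
    also have "tanh (x / 2) ^ (2 * m) = T * T"
      by (simp add: T_def mult_2 power_add)
    also have "real m * T / S * (q x - real m * y x) +
        (((real m)\<^sup>2 * y x + c * S\<^sup>2 * T) / S - real m * (q x / S)) * T - c * (T * T * S) = 0"
      using S by (simp add: field_simps power2_eq_square)
    finally show "(P has_real_derivative 0) (at x)" .
  qed (use r in auto)
  \<comment> \<open>Regularity at the center enters here: for m > 0 the factor T^m vanishes, for m =
    0 the term m y does, and then \<open>q0\<close> remains.\<close>
  also have "P 0 = 0"
    by (cases m) (simp_all add: P_def q0)
  finally show ?thesis by (simp add: P_def)
qed

lemma radial_first_order:
  fixes y :: "real \<Rightarrow> real"
  assumes cont: "continuous_on {0..R} y"
    and y: "\<And>r. r \<in> {0<..<R} \<Longrightarrow> (y has_real_derivative real m * y r / sinh r) (at r)"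
    and r: "r \<in> {0<..R}"
  shows "y r = y R / tanh (R / 2) ^ m * tanh (r / 2) ^ m"
proof (cases "r = R")
  case False
  then have rR: "r < R" using r by simp
  have "y R / tanh (R / 2) ^ m = y r / tanh (r / 2) ^ m"
  proof (rule DERIV_isconst_end[OF rR])
    show "continuous_on {r..R} (\<lambda>x. y x / tanh (x / 2) ^ m)"
      using r by (intro continuous_intros continuous_on_subset[OF cont]) auto
    fix x assume x: "r < x" "x < R"
    define S T where "S = sinh x" and "T = tanh (x / 2) ^ m"
    have S: "S \<noteq> 0" "T \<noteq> 0" "x > 0" using x r by (simp_all add: S_def T_def)
    have "((\<lambda>x. y x / tanh (x / 2) ^ m) has_real_derivative
        (real m * y x / S * T - y x * (real m * T / S)) / (T * T)) (at x)"
      unfolding S_def T_def using x r S(2) unfolding T_def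
      by (intro DERIV_divide tanh_half_power_derivative y) auto
    also have "(real m * y x / S * T - y x * (real m * T / S)) / (T * T) = 0"
      by simp
    finally show "((\<lambda>x. y x / tanh (x / 2) ^ m) has_real_derivative 0) (at x)" .
  qed
  then show ?thesis using r by (simp add: field_simps)
qed (use r in simp)

text \<open>The polar identity projected to frequency m. The function \<open>w\<close> has to agree
  with the Laplacian on the single circle of radius \<open>r\<close> only, so it may be the zero
  function for a biharmonic u and f = \<open>hyp_laplacian u\<close>.\<close>

lemma fourier_bfield_derivative:
  assumes U: "open U" "cball 0 R \<subseteq> U" and f: "smooth_on U f" and r: "r \<in> {0<..<R}"
    and w: "\<And>t. hyp_laplacian f (polar r t) = w (polar r t)"
  shows "(fourier m d (bfield f) has_real_derivative
    ((real m)\<^sup>2 * fourier m d f r + (sinh r)\<^sup>2 * fourier m d w r) / sinh r) (at r)"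
proof -
  let ?L = "hyp_laplacian f"
  have sub: "polar r t \<in> U" for t using r U(2) by (auto simp: subset_iff)
  have smooth: "smooth_on U (bfield (bfield f))" "smooth_on U (rotat (rotat f))" "smooth_on U ?L"
    by (intro smooth_on_bfield smooth_on_rotat smooth_on_hyp_laplacian U f)+
  have int: "(\<lambda>t. g (polar r t) * cos (real m * t + d)) integrable_on {0..2 * pi}" if "smooth_on U g" for g
    using sub by (intro integrable_continuous_real continuous_intros
        continuous_on_compose2[OF smooth_onD_continuous[OF that]]) auto
  have "fourier m d (bfield (bfield f)) r + fourier m d (rotat (rotat f)) r =
      integral {0..2 * pi} (\<lambda>t. bfield (bfield f) (polar r t) * cos (real m * t + d) +
        rotat (rotat f) (polar r t) * cos (real m * t + d))"
    unfolding fourier_def by (rule integral_add[symmetric]; intro int smooth)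
  also have "(\<lambda>t. bfield (bfield f) (polar r t) * cos (real m * t + d) +
        rotat (rotat f) (polar r t) * cos (real m * t + d)) =
      (\<lambda>t. (sinh r)\<^sup>2 * (w (polar r t) * cos (real m * t + d)))"
  proof
    fix t
    have "(sinh r)\<^sup>2 = sqnorm (polar r t) * (beta (polar r t))\<^sup>2"
      by (simp add: sinh_eq_shc beta_def power_mult_distrib)
    then have "bfield (bfield f) (polar r t) + rotat (rotat f) (polar r t) = (sinh r)\<^sup>2 * w (polar r t)"
      using hyp_laplacian_eq[OF U(1) f sub[of t]] w[of t] by simp
    then show "bfield (bfield f) (polar r t) * cos (real m * t + d) +
        rotat (rotat f) (polar r t) * cos (real m * t + d) =
      (sinh r)\<^sup>2 * (w (polar r t) * cos (real m * t + d))"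
      by (simp flip: distrib_right mult.assoc)
  qed
  also have "integral {0..2 * pi} (\<lambda>t. (sinh r)\<^sup>2 * (w (polar r t) * cos (real m * t + d))) =
      (sinh r)\<^sup>2 * fourier m d w r"
    by (simp add: fourier_def)
  finally have "fourier m d (bfield (bfield f)) r =
      (real m)\<^sup>2 * fourier m d f r + (sinh r)\<^sup>2 * fourier m d w r"
    using fourier_rotat_rotat[OF U f, of r m d] r by simp
  then show ?thesis
    using fourier_derivative[OF U smooth_on_bfield[OF U(1) f] r, of m d] by simp
qed

lemma fourier_bfield_0 [simp]: "fourier m d (bfield f) 0 = 0"
  by (simp add: fourier_def polar_def)

text \<open>The coefficient of the Laplacian is c T^m. As the coefficient of u vanishes at R, the
  boundary condition becomes c (\<open>eta m R\<close> - \<open>\<eta>\<close>) \<open>F m R\<close>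
  = 0, so c = 0. Then the coefficient of u is itself a multiple of T^m, and its zero at R makes it
  vanish.\<close>

lemma fourier_eigenfunction:
  assumes R: "R > 0" and U: "open U" "cball 0 R \<subseteq> U" and u: "smooth_on U u"
    and bih: "\<And>x. x \<in> ball 0 R \<Longrightarrow> hyp_laplacian (hyp_laplacian u) x = 0"
    and bc: "\<And>x. x \<in> sphere 0 R \<Longrightarrow> u x = 0 \<and>
      hyp_laplacian u x = \<eta> * frechet_derivative u (at x) (outward_normal x)"
    and neq: "\<eta> \<noteq> eta m R" and r: "r \<in> {0<..R}"
  shows "fourier m d u r = 0"
proof -
  let ?w = "hyp_laplacian u"
  define y q W Q where "y = fourier m d u" and "q = fourier m d (bfield u)"
    and "W = fourier m d ?w" and "Q = fourier m d (bfield ?w)"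
  have w: "smooth_on U ?w" by (rule smooth_on_hyp_laplacian[OF U(1) u])
  have cont: "continuous_on {0..R} y" "continuous_on {0..R} q" "continuous_on {0..R} W" "continuous_on {0..R} Q"
    unfolding y_def q_def W_def Q_def
    by (intro fourier_continuous[OF U] u w smooth_on_bfield U(1))+
  have dy: "(y has_real_derivative q r / sinh r) (at r)" if "r \<in> {0<..<R}" for r
    unfolding y_def q_def by (rule fourier_derivative[OF U u that])
  have dW: "(W has_real_derivative Q r / sinh r) (at r)" if "r \<in> {0<..<R}" for r
    unfolding W_def Q_def by (rule fourier_derivative[OF U w that])
  have dQ: "(Q has_real_derivative ((real m)\<^sup>2 * W r + 0 * (sinh r)\<^sup>2 * tanh (r / 2) ^ m) / sinh r) (at r)"
    if "r \<in> {0<..<R}" for r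
    using fourier_bfield_derivative[OF U w that, of "\<lambda>_. 0" m d] bih that
    by (simp add: Q_def W_def fourier_def)
  have Tpos: "tanh (r / 2) ^ m > 0" if "r > 0" for r :: real using that by simp
  \<comment> \<open>The case c = 0 of \<open>radial_ode\<close>: a harmonic function regular at the
    center satisfies the first-order equation alone.\<close>
  have "Q r = real m * W r" if "r \<in> {0<..<R}" for r
    using radial_ode[OF R cont(3,4) _ dW dQ, of r] Tpos[of r] that by (simp add: Q_def)
  then have dW': "(W has_real_derivative real m * W r / sinh r) (at r)" if "r \<in> {0<..<R}" for r
    using dW[OF that] that by simp
  have Wc: "W r = W R / tanh (R / 2) ^ m * tanh (r / 2) ^ m" if "r \<in> {0<..R}" for r
    by (rule radial_first_order[OF cont(3) dW' that])
  define c where "c = W R / tanh (R / 2) ^ m"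
  have dq: "(q has_real_derivative ((real m)\<^sup>2 * y r + c * (sinh r)\<^sup>2 * tanh (r / 2) ^ m) / sinh r) (at r)"
    if "r \<in> {0<..<R}" for r
    using fourier_bfield_derivative[OF U u that, of ?w m d] Wc[of r] that
    unfolding q_def[symmetric] W_def[symmetric] y_def[symmetric] c_def[symmetric] by (simp add: mult_ac)
  have P: "tanh (r / 2) ^ m * (q r - real m * y r) = c * F m r" if "r \<in> {0..R}" for r
    by (rule radial_ode[OF R cont(1,2) _ dy dq that]) (simp add: q_def)
  have sph: "polar R t \<in> sphere 0 R" for t using R by simp
  have yR: "y R = 0" using bc[OF sph] by (simp add: y_def fourier_def)
  have "W R = \<eta> / sinh R * q R"
  proof -
    have "?w (polar R t) = \<eta> / sinh R * bfield u (polar R t)" for t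
    proof -
      have "polar R t \<in> U" using sph[of t] U(2) by auto
      moreover have "polar R t \<noteq> 0" using norm_polar[of R t] R by force
      ultimately have "polar R t \<in> U" "polar R t \<noteq> 0" .
      then show ?thesis
        using bc[OF sph[of t]] frechet_derivative_outward_normal[of u "polar R t"]
          smooth_onD_differentiable[OF u] R by simp
    qed
    then have "W R = integral {0..2 * pi}
        (\<lambda>t. \<eta> / sinh R * (bfield u (polar R t) * cos (real m * t + d)))"
      by (simp only: W_def fourier_def mult.assoc)
    then show ?thesis unfolding q_def fourier_def by (simp only: integral_mult_right)
  qed
  moreover define S T where "S = sinh R" and "T = tanh (R / 2) ^ m"
  ultimately have W1: "S * W R = \<eta> * q R" using R by simp
  have W2: "W R = c * T" using R by (simp add: c_def T_def)
  have P': "T * q R = c * F m R" using P[of R] R yR by (simp add: T_def)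
  have "c * (S * T * T - \<eta> * F m R) = 0"
    using W1 P' unfolding W2 by algebra
  moreover have "eta m R * F m R = S * T * T"
    using F_pos[OF R, of m] by (simp add: eta_def S_def T_def mult_2 power_add)
  ultimately have "c * ((eta m R - \<eta>) * F m R) = 0"
    by (simp add: left_diff_distrib)
  then have "c = 0" using neq F_pos[OF R, of m] by simp
  then have "q r = real m * y r" if "r \<in> {0<..<R}" for r
    using P[of r] Tpos[of r] that by simp
  then have dy': "(y has_real_derivative real m * y r / sinh r) (at r)" if "r \<in> {0<..<R}" for r
    using dy[OF that] that by simp
  have "y r = y R / tanh (R / 2) ^ m * tanh (r / 2) ^ m"
    by (rule radial_first_order[OF cont(1) dy' r])
  then show ?thesis using yR by (simp add: y_def)
qed

text \<open>Otherwise all Fourier coefficients on all circles would vanish, which makes the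
  eigenfunction zero off the center by completeness and at the center by continuity.\<close>

lemma steklov2_eigenvalue_imp_eta:
  assumes R: "R > 0" and "steklov2_eigenvalue R \<eta>"
  shows "\<exists>m. \<eta> = eta m R"
proof (rule ccontr)
  assume neq: "\<nexists>m. \<eta> = eta m R"
  obtain U u where U: "open U" "cball 0 R \<subseteq> U" and u: "smooth_on U u"
    and nz: "\<exists>x\<in>cball 0 R. u x \<noteq> 0"
    and bih: "\<And>x. x \<in> ball 0 R \<Longrightarrow> hyp_laplacian (hyp_laplacian u) x = 0"
    and bc: "\<And>x. x \<in> sphere 0 R \<Longrightarrow> u x = 0 \<and>
      hyp_laplacian u x = \<eta> * frechet_derivative u (at x) (outward_normal x)"
    using assms(2) unfolding steklov2_eigenvalue_def by blast
  have zero: "u x = 0" if "x \<noteq> 0" "x \<in> cball 0 R" for x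
  proof (rule fourier_complete)
    show "continuous_on (sphere 0 (norm x)) u"
      using that U(2) by (intro continuous_on_subset[OF smooth_onD_continuous[OF u]]) auto
    show "fourier m d u (norm x) = 0" for m d
      by (rule fourier_eigenfunction[OF R U u bih bc]) (use neq that in auto)
  qed auto
  have "0 \<in> U" using U(2) R by (simp add: subset_iff)
  then have "isCont u 0"
    by (intro differentiable_imp_continuous_within smooth_onD_differentiable[OF u])
  then have "(u \<longlongrightarrow> u 0) (at 0)" by (simp add: isCont_def)
  moreover have "eventually (\<lambda>x. u x = 0) (at 0)"
    unfolding eventually_at using zero R by (intro exI[of _ R]) auto
  then have "(u \<longlongrightarrow> 0) (at 0)" by (rule tendsto_eventually)
  ultimately have "u 0 = 0" by (rule LIM_unique)
  with zero nz show False by metis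
qed

section \<open>The eigenvalues in increasing order\<close>

text \<open>For x < R the factor tanh^2 (x/2) by which the integrands differ stays below its end
  value T^2, so \<open>F (Suc m) R\<close> is less than T^2 \<open>F m R\<close>.\<close>

lemma eta_less_Suc:
  assumes R: "R > 0"
  shows "eta m R < eta (Suc m) R"
proof -
  define T where "T = tanh (R / 2)"
  have T: "T > 0" using R by (simp add: T_def)
  have "F (Suc m) 0 - T\<^sup>2 * F m 0 > F (Suc m) R - T\<^sup>2 * F m R"
  proof (rule DERIV_neg_imp_decreasing_open[OF R])
    fix x assume x: "0 < x" "x < R"
    have "((\<lambda>x. F (Suc m) x - T\<^sup>2 * F m x) has_real_derivative
        tanh (x / 2) ^ (2 * Suc m) * sinh x - T\<^sup>2 * (tanh (x / 2) ^ (2 * m) * sinh x)) (at x)"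
      by (intro DERIV_diff DERIV_cmult F_derivative)
    moreover have "tanh (x / 2) ^ (2 * Suc m) * sinh x < T\<^sup>2 * (tanh (x / 2) ^ (2 * m) * sinh x)"
    proof -
      have "(tanh (x / 2))\<^sup>2 < T\<^sup>2"
        using x by (intro power_strict_mono) (simp_all add: T_def)
      then have "(tanh (x / 2))\<^sup>2 * (tanh (x / 2) ^ (2 * m) * sinh x) < T\<^sup>2 * (tanh (x / 2) ^ (2 * m) * sinh x)"
        by (rule mult_strict_right_mono) (use x in simp)
      then show ?thesis by (simp add: power2_eq_square mult_ac)
    qed
    ultimately show "\<exists>y. ((\<lambda>x. F (Suc m) x - T\<^sup>2 * F m x) has_real_derivative y) (at x) \<and> y < 0"
      by (intro exI conjI) (assumption, linarith)
  next
    show "continuous_on {0..R} (\<lambda>x. F (Suc m) x - T\<^sup>2 * F m x)"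
      by (intro continuous_intros continuous_at_imp_continuous_on ballI DERIV_isCont[OF F_derivative])
  qed
  then have "F (Suc m) R < T\<^sup>2 * F m R" by simp
  moreover have "F m R > 0" "F (Suc m) R > 0" using F_pos R by simp_all
  moreover have "sinh R * T ^ (2 * m) > 0" using R T by simp
  ultimately have "sinh R * T ^ (2 * m) * F (Suc m) R < sinh R * T ^ (2 * m) * (T\<^sup>2 * F m R)"
    by (intro mult_strict_left_mono)
  with F_pos[OF R, of m] F_pos[OF R, of "Suc m"] show ?thesis
    unfolding eta_def T_def[symmetric] by (simp add: divide_simps power2_eq_square mult_ac)
qed

lemma strict_mono_eta: "R > 0 \<Longrightarrow> strict_mono (\<lambda>m. eta m R)"
  by (simp add: strict_mono_Suc_iff eta_less_Suc)

lemma steklov2_eigenvalue_iff: "R > 0 \<Longrightarrow> steklov2_eigenvalue R \<eta> \<longleftrightarrow> (\<exists>m. \<eta> = eta m R)"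
  using steklov2_eigenvalue_eta steklov2_eigenvalue_imp_eta by blast

text \<open>The eigenvalues are the range of a strictly increasing sequence, so each
  \<open>LEAST\<close> picks its next member.\<close>

lemma steklov2_eta_eq:
  assumes R: "R > 0"
  shows "steklov2_eta m R = eta m R"
proof (induction m)
  case 0
  have "eta 0 R \<le> eta k R" for k
    using strict_mono_less_eq[OF strict_mono_eta[OF R]] by simp
  then show ?case
    by (auto simp: steklov2_eigenvalue_iff[OF R] intro!: Least_equality)
next
  case (Suc m)
  have "eta (Suc m) R \<le> eta k R" if "eta m R < eta k R" for k
    using that strict_mono_less_eq[OF strict_mono_eta[OF R]] strict_mono_less[OF strict_mono_eta[OF R]]
    by simp
  then show ?case
    by (auto simp: Suc steklov2_eigenvalue_iff[OF R] eta_less_Suc[OF R] intro!: Least_equality)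
qed

section \<open>Monotonicity of the rescaled eigenvalues\<close>

text \<open>The function is negative up to \<open>a\<close> and strictly increasing from there on,
  so its positive value at \<open>x0\<close> forces exactly one zero on the positive axis.\<close>

lemma sign_change:
  fixes f :: "real \<Rightarrow> real"
  assumes cont: "continuous_on {0..} f" and f0: "f 0 = 0" and a: "a > 0"
    and der: "\<And>x. x > 0 \<Longrightarrow> (f has_real_derivative f' x) (at x)"
    and neg: "\<And>x. 0 < x \<Longrightarrow> x < a \<Longrightarrow> f' x < 0" and pos: "\<And>x. a < x \<Longrightarrow> f' x > 0"
    and x0: "x0 > 0" "f x0 > 0"
  obtains b where "b > 0" "\<And>x. 0 < x \<Longrightarrow> x < b \<Longrightarrow> f x < 0" "\<And>x. b < x \<Longrightarrow> f x > 0"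
proof -
  have left: "f x < 0" if "0 < x" "x \<le> a" for x
  proof -
    have "f x < f 0"
    proof (rule DERIV_neg_imp_decreasing_open[OF that(1)])
      show "\<exists>D. (f has_real_derivative D) (at z) \<and> D < 0" if "0 < z" "z < x" for z
        using der[of z] neg[of z] that \<open>x \<le> a\<close> by (intro exI[of _ "f' z"]) auto
    qed (auto intro: continuous_on_subset[OF cont])
    with f0 show ?thesis by simp
  qed
  have right: "f x < f y" if "a \<le> x" "x < y" for x y
  proof (rule DERIV_pos_imp_increasing_open[OF that(2)])
    show "\<exists>D. (f has_real_derivative D) (at z) \<and> 0 < D" if "x < z" for z
      using der[of z] pos[of z] that \<open>a \<le> x\<close> a by (intro exI[of _ "f' z"]) auto
  qed (use that a in \<open>auto intro: continuous_on_subset[OF cont]\<close>)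
  have ax0: "a < x0" using left[of x0] x0 by fastforce
  obtain b where b: "a \<le> b" "b \<le> x0" "f b = 0"
    using IVT'[of f a 0 x0] left[of a] a x0 ax0 continuous_on_subset[OF cont, of "{a..x0}"] by fastforce
  have ab: "a < b" using b left[of a] a by (cases "a = b") auto
  show ?thesis
  proof (rule that[of b])
    show "f x < 0" if "0 < x" "x < b" for x
      using left[of x] right[of x b] that b by (cases "x \<le> a") auto
    show "f x > 0" if "b < x" for x
      using right[of b x] that b by auto
  qed (use ab a in simp)
qed

text \<open>For a quotient \<open>H / F\<close> with \<open>H' = \<rho> F'\<close> the derivative has the sign of \<open>\<rho> F - H\<close>, whose own
  derivative is \<open>\<rho>' F\<close>; as \<open>\<rho> F - H\<close> vanishes at 0, the signs of \<open>\<rho>'\<close> determine the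
  monotonicity.\<close>

locale monotone_quotient =
  fixes m :: nat and H \<rho> \<rho>' :: "real \<Rightarrow> real"
  assumes H_cont: "continuous_on {0..} H" and H_0: "H 0 = 0" and \<rho>_cont: "continuous_on {0..} \<rho>"
    and H_deriv: "\<And>x. x > 0 \<Longrightarrow>
      (H has_real_derivative tanh (x / 2) ^ (2 * m) * sinh x * \<rho> x) (at x)"
    and \<rho>_deriv: "\<And>x. x > 0 \<Longrightarrow> (\<rho> has_real_derivative \<rho>' x) (at x)"
begin

definition K :: "real \<Rightarrow> real" where "K x = \<rho> x * F m x - H x"

lemma K_0: "K 0 = 0"
  by (simp add: K_def H_0)

lemma K_cont: "continuous_on {0..} K"
  unfolding K_def
  by (intro continuous_intros H_cont \<rho>_cont continuous_at_imp_continuous_on ballI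
      DERIV_isCont[OF F_derivative])

lemma K_deriv: "x > 0 \<Longrightarrow> (K has_real_derivative \<rho>' x * F m x) (at x)"
  unfolding K_def
  using DERIV_diff[OF DERIV_mult[OF \<rho>_deriv F_derivative[of m x]] H_deriv]
  by (simp add: mult_ac)

lemma quotient_deriv:
  assumes "x > 0"
  shows "((\<lambda>x. H x / F m x) has_real_derivative
    tanh (x / 2) ^ (2 * m) * sinh x * K x / (F m x * F m x)) (at x)"
  using DERIV_divide[OF H_deriv[OF assms] F_derivative] F_pos[OF assms, of m]
  by (simp add: K_def algebra_simps)

lemma weight_pos: "x > 0 \<Longrightarrow> tanh (x / 2) ^ (2 * m) * sinh x / (F m x * F m x) > 0"
  using F_pos[of x m] by simp

lemma quotient_increasing:
  assumes "0 < x" "x < y" "\<And>z. x \<le> z \<Longrightarrow> z \<le> y \<Longrightarrow> K z > 0"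
  shows "H x / F m x < H y / F m y"
proof (rule DERIV_pos_imp_increasing[OF assms(2)])
  fix z assume z: "x \<le> z" "z \<le> y"
  with assms(1) have "z > 0" by simp
  from quotient_deriv[OF this] mult_pos_pos[OF weight_pos[OF this] assms(3)[OF z]]
  show "\<exists>D. ((\<lambda>x. H x / F m x) has_real_derivative D) (at z) \<and> 0 < D" by auto
qed

lemma quotient_decreasing:
  assumes "0 < x" "x < y" "\<And>z. x \<le> z \<Longrightarrow> z \<le> y \<Longrightarrow> K z < 0"
  shows "H x / F m x > H y / F m y"
proof (rule DERIV_neg_imp_decreasing[OF assms(2)])
  fix z assume z: "x \<le> z" "z \<le> y"
  with assms(1) have "z > 0" by simp
  from quotient_deriv[OF this] mult_pos_neg[OF weight_pos[OF this] assms(3)[OF z]]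
  show "\<exists>D. ((\<lambda>x. H x / F m x) has_real_derivative D) (at z) \<and> D < 0" by auto
qed

lemma K_mono_sign:
  assumes "x > 0"
  shows "(\<And>z. z > 0 \<Longrightarrow> \<rho>' z > 0) \<Longrightarrow> K x > 0" "(\<And>z. z > 0 \<Longrightarrow> \<rho>' z < 0) \<Longrightarrow> K x < 0"
proof -
  have c: "continuous_on {0..x} K" by (rule continuous_on_subset[OF K_cont]) auto
  show "K x > 0" if p: "\<And>z. z > 0 \<Longrightarrow> \<rho>' z > 0"
  proof -
    have "K 0 < K x"
      by (rule DERIV_pos_imp_increasing_open[OF assms _ c])
         (use K_deriv F_pos p in \<open>meson mult_pos_pos\<close>)
    then show ?thesis by (simp add: K_0)
  qed
  show "K x < 0" if p: "\<And>z. z > 0 \<Longrightarrow> \<rho>' z < 0"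
  proof -
    have "K 0 > K x"
      by (rule DERIV_neg_imp_decreasing_open[OF assms _ c])
         (use K_deriv F_pos p in \<open>meson mult_neg_pos\<close>)
    then show ?thesis by (simp add: K_0)
  qed
qed

lemma quotient_strict_mono:
  assumes "\<And>x. x > 0 \<Longrightarrow> \<rho>' x > 0"
  shows "strict_mono_on {0<..} (\<lambda>x. H x / F m x)"
  by (rule strict_mono_onI) (auto intro!: quotient_increasing K_mono_sign(1) assms)

lemma quotient_strict_antimono:
  assumes "\<And>x. x > 0 \<Longrightarrow> \<rho>' x < 0"
  shows "strict_antimono_on {0<..} (\<lambda>x. H x / F m x)"
  by (rule monotone_onI) (auto intro!: quotient_decreasing K_mono_sign(2) assms)

text \<open>If \<open>K\<close> were never positive, the quotient would be nonincreasing, hence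
  bounded above for x at least 1. So \<open>K\<close> becomes positive, and the signs of
  \<open>\<rho>'\<close> leave it a single change of sign.\<close>

lemma quotient_valley:
  assumes a: "a > 0" and neg: "\<And>x. 0 < x \<Longrightarrow> x < a \<Longrightarrow> \<rho>' x < 0" and pos: "\<And>x. a < x \<Longrightarrow> \<rho>' x > 0"
    and unbounded: "\<And>B. \<exists>x\<ge>1. H x / F m x > B"
  shows "\<exists>b>0. strict_antimono_on {0<..<b} (\<lambda>x. H x / F m x) \<and>
    strict_mono_on {b<..} (\<lambda>x. H x / F m x)"
proof -
  have "\<exists>x>0. K x > 0"
  proof (rule ccontr)
    assume K: "\<not> (\<exists>x>0. K x > 0)"
    have "H x / F m x \<le> H 1 / F m 1" if "x \<ge> 1" for x
    proof (rule DERIV_nonpos_imp_nonincreasing[OF that])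
      fix z :: real assume "1 \<le> z" "z \<le> x"
      then have z: "z > 0" by simp
      then have "K z \<le> 0" using K by force
      from quotient_deriv[OF z] mult_nonneg_nonpos[OF less_imp_le[OF weight_pos[OF z]] this]
      show "\<exists>D. ((\<lambda>x. H x / F m x) has_real_derivative D) (at z) \<and> D \<le> 0" by auto
    qed
    with unbounded[of "H 1 / F m 1"] show False by fastforce
  qed
  then obtain x0 where x0: "x0 > 0" "K x0 > 0" by blast
  obtain b where b: "b > 0" "\<And>x. 0 < x \<Longrightarrow> x < b \<Longrightarrow> K x < 0" "\<And>x. b < x \<Longrightarrow> K x > 0"
  proof (rule sign_change[OF K_cont K_0 a K_deriv _ _ x0])
    show "\<rho>' x * F m x < 0" if "0 < x" "x < a" for x
      using neg[OF that] F_pos[OF that(1)] by (rule mult_neg_pos)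
    show "\<rho>' x * F m x > 0" if "a < x" for x
      using pos[OF that] F_pos[of x] that a by (intro mult_pos_pos) auto
  qed auto
  have "strict_antimono_on {0<..<b} (\<lambda>x. H x / F m x)"
    by (rule monotone_onI) (auto intro!: quotient_decreasing b(2))
  moreover have "strict_mono_on {b<..} (\<lambda>x. H x / F m x)"
    by (rule strict_mono_onI) (use b(1) in \<open>auto intro!: quotient_increasing b(3)\<close>)
  ultimately show ?thesis using b(1) by blast
qed

end

section \<open>The four weights R, sinh R, tanh (R/2) and sinh (R/2)\<close>

lemma cosh_real_nonzero: "cosh x \<noteq> (0 :: real)"
  by (metis cosh_real_pos less_irrefl)

lemma numerator_derivative:
  assumes w: "(w has_real_derivative w') (at x)" and x: "x > 0"
  shows "((\<lambda>x. tanh (x / 2) ^ (2 * m) * sinh x * w x) has_real_derivative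
    tanh (x / 2) ^ (2 * m) * sinh x * (w' + w x * (cosh x + 2 * real m) / sinh x)) (at x)"
proof -
  define T S where "T = tanh (x / 2) ^ (2 * m)" and "S = sinh x"
  have S: "S \<noteq> 0" using x by (simp add: S_def)
  have sinh: "(sinh has_real_derivative cosh x) (at x)" by (auto intro!: derivative_eq_intros)
  have "((\<lambda>x. tanh (x / 2) ^ (2 * m) * sinh x * w x) has_real_derivative
      (real (2 * m) * T / S * S + cosh x * T) * w x + w' * (T * S)) (at x)"
    unfolding T_def S_def by (intro DERIV_mult tanh_half_power_derivative[OF x] sinh w)
  also have "(real (2 * m) * T / S * S + cosh x * T) * w x + w' * (T * S) =
      T * S * (w' + w x * (cosh x + 2 * real m) / S)"
    using S by (simp add: field_simps)
  finally show ?thesis by (simp add: T_def S_def)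
qed

text \<open>The formula for \<open>\<rho>\<close> divides by sinh x and is available for x > 0 only;
  its continuous extension to 0 is supplied as \<open>\<rho>\<close>, because the argument starts
  from the value of \<open>\<rho>\<close> F - H at 0.\<close>

lemma monotone_quotientI:
  assumes "continuous_on {0..} w" "continuous_on {0..} \<rho>"
    and "\<And>x. x > 0 \<Longrightarrow> (w has_real_derivative w' x) (at x)"
    and "\<And>x. x > 0 \<Longrightarrow> \<rho> x = w' x + w x * (cosh x + 2 * real m) / sinh x"
    and "\<And>x. x > 0 \<Longrightarrow> (\<rho> has_real_derivative \<rho>' x) (at x)"
  shows "monotone_quotient m (\<lambda>x. tanh (x / 2) ^ (2 * m) * sinh x * w x) \<rho> \<rho>'"
proof
  show "continuous_on {0..} (\<lambda>x. tanh (x / 2) ^ (2 * m) * sinh x * w x)"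
    by (intro continuous_intros assms(1) cosh_real_nonzero ballI) simp
qed (use assms numerator_derivative in auto)

lemma eta_times: "tanh (x / 2) ^ (2 * m) * sinh x * w / F m x = eta m x * w"
  by (simp add: eta_def)

lemma sinh_greater: "x > 0 \<Longrightarrow> sinh x > (x :: real)"
proof -
  assume x: "x > 0"
  have "sinh 0 - 0 < sinh x - x"
  proof (rule DERIV_pos_imp_increasing_open[OF x])
    fix z :: real assume "0 < z"
    then have "cosh z > 1" using cosh_real_strict_mono[of 0 z] by simp
    then show "\<exists>D. ((\<lambda>x. sinh x - x) has_real_derivative D) (at z) \<and> 0 < D"
      by (intro exI[of _ "cosh z - 1"]) (auto intro!: derivative_eq_intros)
  qed (intro continuous_intros)
  then show ?thesis by simp
qed

text \<open>Both sides of F <= T^(2 m) sinh x vanish at 0, and the derivative T^(2 m) (cosh x + 2 m)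
  on the right exceeds T^(2 m) sinh x on the left.\<close>

lemma eta_ge_1:
  assumes x: "x > 0"
  shows "eta m x \<ge> 1"
proof -
  let ?f = "\<lambda>x. tanh (x / 2) ^ (2 * m) * sinh x * 1 - F m x"
  have "?f 0 < ?f x"
  proof (rule DERIV_pos_imp_increasing_open[OF x])
    fix z assume z: "0 < z" "z < x"
    define T where "T = tanh (z / 2) ^ (2 * m)"
    have "(?f has_real_derivative T * sinh z * (0 + 1 * (cosh z + 2 * real m) / sinh z) - T * sinh z) (at z)"
      unfolding T_def by (intro DERIV_diff F_derivative numerator_derivative DERIV_const z)
    moreover have "T * sinh z * (0 + 1 * (cosh z + 2 * real m) / sinh z) - T * sinh z =
        T * (cosh z - sinh z + 2 * real m)"
      using z by (simp add: field_simps)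
    moreover have "T > 0" "cosh z - sinh z + 2 * real m > 0"
      using z sinh_less_cosh_real[of z] by (simp_all add: T_def add_pos_nonneg)
    ultimately have "(?f has_real_derivative T * (cosh z - sinh z + 2 * real m)) (at z)"
      "T * (cosh z - sinh z + 2 * real m) > 0" by simp_all
    then show "\<exists>D. (?f has_real_derivative D) (at z) \<and> 0 < D" by blast
  next
    show "continuous_on {0..x} ?f"
      by (intro continuous_intros continuous_at_imp_continuous_on[of _ "F m"] ballI
          DERIV_isCont[OF F_derivative] cosh_real_nonzero) simp
  qed
  then have "F m x < sinh x * tanh (x / 2) ^ (2 * m)" by (simp add: mult.commute)
  then show ?thesis using F_pos[OF x, of m] by (simp add: eta_def)
qed

text \<open>The bound x/2 is chosen to cover both weights that produce a valley, x and sinh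
  (x/2).\<close>

lemma eta_times_unbounded:
  assumes "\<And>x. x > 0 \<Longrightarrow> w x \<ge> x / 2"
  shows "\<exists>x\<ge>1. tanh (x / 2) ^ (2 * m) * sinh x * w x / F m x > B"
proof (intro exI conjI)
  define x where "x = 2 * (\<bar>B\<bar> + 1)"
  show x: "x \<ge> 1" by (simp add: x_def)
  have "B < x / 2" by (simp add: x_def)
  also have "\<dots> \<le> w x" using assms x by simp
  also have "\<dots> \<le> eta m x * w x"
    using mult_right_mono[OF eta_ge_1[of x m], of "w x"] assms[of x] x by simp
  finally show "B < tanh (x / 2) ^ (2 * m) * sinh x * w x / F m x" by (simp only: eta_times)
qed

lemma sinh_quotient:
  "monotone_quotient m (\<lambda>x. tanh (x / 2) ^ (2 * m) * sinh x * sinh x)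
     (\<lambda>x. 2 * cosh x + 2 * real m) (\<lambda>x. 2 * sinh x)"
  by (rule monotone_quotientI[where w' = cosh])
     (auto intro!: continuous_intros derivative_eq_intros simp: field_simps)

text \<open>As tanh (x/2) / sinh x = 1 / (1 + cosh x), both summands of \<open>\<rho>\<close> share
  the denominator 1 + cosh x.\<close>

lemma tanh_half_quotient:
  "monotone_quotient m (\<lambda>x. tanh (x / 2) ^ (2 * m) * sinh x * tanh (x / 2))
     (\<lambda>x. 1 + 2 * real m / (1 + cosh x)) (\<lambda>x. - (2 * real m * sinh x) / (1 + cosh x)\<^sup>2)"
proof (rule monotone_quotientI[where w' = "\<lambda>x. 1 / (1 + cosh x)"])
  have c: "1 + cosh x \<noteq> 0" for x :: real using cosh_real_pos[of x] by linarith
  show "continuous_on {0..} (\<lambda>x::real. tanh (x / 2))" by (intro continuous_intros cosh_real_nonzero) auto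
  show "continuous_on {0..} (\<lambda>x. 1 + 2 * real m / (1 + cosh x))"
    by (intro continuous_intros) (use c in auto)
  show "((\<lambda>x. tanh (x / 2)) has_real_derivative 1 / (1 + cosh x)) (at x)" for x
    by (rule tanh_half_derivative)
  show "1 + 2 * real m / (1 + cosh x) =
      1 / (1 + cosh x) + tanh (x / 2) * (cosh x + 2 * real m) / sinh x" if "x > 0" for x
    using c[of x] that by (simp add: tanh_half divide_simps)
  show "((\<lambda>x. 1 + 2 * real m / (1 + cosh x)) has_real_derivative
      - (2 * real m * sinh x) / (1 + cosh x)\<^sup>2) (at x)" for x
    using c[of x] by (auto intro!: derivative_eq_intros simp: power2_eq_square)
qed

text \<open>With C = cosh (x/2), the formulas cosh x = 2 C^2 - 1 and sinh x = 2 sinh (x/2) C express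
  \<open>\<rho>\<close> through C alone.\<close>

lemma sinh_half_quotient:
  "monotone_quotient m (\<lambda>x. tanh (x / 2) ^ (2 * m) * sinh x * sinh (x / 2))
     (\<lambda>x. 3 / 2 * cosh (x / 2) + (2 * real m - 1) / (2 * cosh (x / 2)))
     (\<lambda>x. sinh (x / 2) * (3 * (cosh (x / 2))\<^sup>2 - (2 * real m - 1)) / (4 * (cosh (x / 2))\<^sup>2))"
proof (rule monotone_quotientI[where w' = "\<lambda>x. cosh (x / 2) / 2"])
  note c = cosh_real_nonzero
  show "continuous_on {0..} (\<lambda>x::real. sinh (x / 2))" by (intro continuous_intros) auto
  show "continuous_on {0..} (\<lambda>x. 3 / 2 * cosh (x / 2) + (2 * real m - 1) / (2 * cosh (x / 2)))"
    by (intro continuous_intros) (use c in auto)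
  show "((\<lambda>x. sinh (x / 2)) has_real_derivative cosh (x / 2) / 2) (at x)" for x :: real
    by (auto intro!: derivative_eq_intros)
  show "3 / 2 * cosh (x / 2) + (2 * real m - 1) / (2 * cosh (x / 2)) =
      cosh (x / 2) / 2 + sinh (x / 2) * (cosh x + 2 * real m) / sinh x" if "x > 0" for x :: real
  proof -
    have "sinh x = 2 * sinh (x / 2) * cosh (x / 2)" "cosh x = 2 * (cosh (x / 2))\<^sup>2 - 1"
      using sinh_double[of "x / 2"] cosh_double_cosh[of "x / 2"] by simp_all
    moreover have "sinh (x / 2) \<noteq> 0" using that by simp
    ultimately show ?thesis
      using c[of "x / 2"] by (simp add: divide_simps power2_eq_square)
  qed
  show "((\<lambda>x. 3 / 2 * cosh (x / 2) + (2 * real m - 1) / (2 * cosh (x / 2))) has_real_derivative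
      sinh (x / 2) * (3 * (cosh (x / 2))\<^sup>2 - (2 * real m - 1)) / (4 * (cosh (x / 2))\<^sup>2)) (at x)" for x
    using c[of "x / 2"]
    by (auto intro!: derivative_eq_intros simp: power2_eq_square divide_simps)
       (simp add: algebra_simps)
qed

text \<open>Writing x / sinh x as 1 / \<open>shc (x\<^sup>2)\<close> extends \<open>\<rho>\<close>
  continuously to 0; the derivative is computed from the quotient by sinh x on the open
  half-line.\<close>

lemma radius_quotient:
  "monotone_quotient m (\<lambda>x. tanh (x / 2) ^ (2 * m) * sinh x * x)
     (\<lambda>x. 1 + (cosh x + 2 * real m) / shc (x\<^sup>2))
     (\<lambda>x. (sinh x * cosh x - x + 2 * real m * (sinh x - x * cosh x)) / (sinh x)\<^sup>2)"
proof (rule monotone_quotientI[where w' = "\<lambda>x. 1"])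
  have nz: "shc (x\<^sup>2) \<noteq> 0" for x using shc_ge_1[of "x\<^sup>2"] by auto
  have cont: "continuous_on UNIV shc"
    using smooth_real_on_series(1) unfolding smooth_real_on_def
    by (metis DERIV_isCont UNIV_I continuous_at_imp_continuous_on)
  have cont2: "continuous_on {0..} (\<lambda>x. shc (x\<^sup>2))"
    by (rule continuous_on_compose2[OF cont]) (auto intro!: continuous_intros)
  show "continuous_on {0..} (\<lambda>x. 1 + (cosh x + 2 * real m) / shc (x\<^sup>2))"
    by (intro continuous_on_add continuous_on_divide continuous_on_const cont2 ballI nz)
       (intro continuous_intros)
  show eq: "1 + (cosh x + 2 * real m) / shc (x\<^sup>2) = 1 + x * (cosh x + 2 * real m) / sinh x"
    if "x > 0" for x
    using that by (simp add: sinh_eq_shc)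
  show "((\<lambda>x. 1 + (cosh x + 2 * real m) / shc (x\<^sup>2)) has_real_derivative
      (sinh x * cosh x - x + 2 * real m * (sinh x - x * cosh x)) / (sinh x)\<^sup>2) (at x)"
    if x: "x > 0" for x
  proof (rule has_field_derivative_transform_within_open[of _ _ _ "{0<..}"])
    have s: "sinh x \<noteq> 0" using x by simp
    have "((\<lambda>x. 1 + x * (cosh x + 2 * real m) / sinh x) has_real_derivative
        0 + ((1 * (cosh x + 2 * real m) + (sinh x + 0) * x) * sinh x -
          x * (cosh x + 2 * real m) * cosh x) / (sinh x * sinh x)) (at x)"
      by (intro DERIV_add DERIV_divide DERIV_mult DERIV_const DERIV_ident s)
         (auto intro!: derivative_eq_intros)
    also have "0 + ((1 * (cosh x + 2 * real m) + (sinh x + 0) * x) * sinh x -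
          x * (cosh x + 2 * real m) * cosh x) / (sinh x * sinh x) =
        (sinh x * cosh x - x + 2 * real m * (sinh x - x * cosh x)) / (sinh x)\<^sup>2"
    proof -
      have "cosh x * cosh x = sinh x * sinh x + 1"
        using cosh_square_eq[of x] by (simp add: power2_eq_square)
      then have "(1 * (cosh x + 2 * real m) + (sinh x + 0) * x) * sinh x -
          x * (cosh x + 2 * real m) * cosh x =
          sinh x * cosh x - x + 2 * real m * (sinh x - x * cosh x)" by algebra
      then show ?thesis by (simp add: power2_eq_square)
    qed
    finally show "((\<lambda>x. 1 + x * (cosh x + 2 * real m) / sinh x) has_real_derivative
      (sinh x * cosh x - x + 2 * real m * (sinh x - x * cosh x)) / (sinh x)\<^sup>2) (at x)" .
  qed (use x eq in auto)
qed (auto intro!: continuous_intros)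

text \<open>Reduces the sign of the numerator to that of sinh x - m x, which is positive for m = 1
  and x > 0 and changes sign once for larger m.\<close>

lemma radius_numerator_derivative:
  "((\<lambda>x. sinh x * cosh x - x + 2 * real m * (sinh x - x * cosh x)) has_real_derivative
    2 * sinh x * (sinh x - real m * x)) (at x)"
proof -
  have "((\<lambda>x. sinh x * cosh x - x + 2 * real m * (sinh x - x * cosh x)) has_real_derivative
      cosh x * cosh x + sinh x * sinh x - 1 + 2 * real m * (cosh x - (1 * cosh x + sinh x * x))) (at x)"
    by (intro DERIV_add DERIV_diff DERIV_mult DERIV_cmult DERIV_ident)
       (auto intro!: derivative_eq_intros)
  moreover have "cosh x * cosh x = sinh x * sinh x + 1"
    using cosh_square_eq[of x] by (simp add: power2_eq_square)
  ultimately show ?thesis by (simp add: algebra_simps)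
qed

lemma cosh_threshold:
  assumes "v > (1 :: real)"
  obtains a where "a > 0" "\<And>x. 0 < x \<Longrightarrow> x < a \<Longrightarrow> cosh x < v" "\<And>x. a < x \<Longrightarrow> v < cosh x"
proof (rule that[of "arcosh v"])
  have v: "cosh (arcosh v) = v" "arcosh v \<ge> 0"
    using assms by (simp_all add: cosh_arcosh_real)
  then show a: "arcosh v > 0" using assms by (cases "arcosh v = 0") auto
  show "cosh x < v" if "0 < x" "x < arcosh v" for x
    using cosh_real_strict_mono[of x "arcosh v"] that v by simp
  show "v < cosh x" if "arcosh v < x" for x
    using cosh_real_strict_mono[of "arcosh v" x] that v by simp
qed

text \<open>\<open>sign_change\<close> is used twice: the single sign change of cosh x - m passes to
  sinh x - m x and from there to N. Growth at infinity supplies the positive values that both uses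
  require.\<close>

lemma radius_numerator_sign:
  assumes "m \<ge> 2"
  defines "N \<equiv> \<lambda>x. sinh x * cosh x - x + 2 * real m * (sinh x - x * cosh x)"
  obtains b where "b > 0" "\<And>x. 0 < x \<Longrightarrow> x < b \<Longrightarrow> N x < 0" "\<And>x. b < x \<Longrightarrow> N x > 0"
proof -
  obtain a where a: "a > 0" "\<And>x. 0 < x \<Longrightarrow> x < a \<Longrightarrow> cosh x < real m" "\<And>x. a < x \<Longrightarrow> real m < cosh x"
    using cosh_threshold[of "real m"] assms by auto
  have "eventually (\<lambda>x. sinh x - real m * x > 0) at_top"
    unfolding sinh_field_def by real_asymp
  from eventually_happens'[OF trivial_limit_at_top_linorder eventually_conj[OF this eventually_gt_at_top[of 0]]]
  obtain x1 where x1: "x1 > 0" "sinh x1 - real m * x1 > 0" by blast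
  obtain b where b: "b > 0" "\<And>x. 0 < x \<Longrightarrow> x < b \<Longrightarrow> sinh x - real m * x < 0"
    "\<And>x. b < x \<Longrightarrow> sinh x - real m * x > 0"
  proof (rule sign_change[of "\<lambda>x. sinh x - real m * x", OF _ _ a(1) _ _ _ x1])
    show "((\<lambda>x. sinh x - real m * x) has_real_derivative cosh x - real m) (at x)" for x
      by (auto intro!: derivative_eq_intros)
  qed (use a in \<open>auto intro!: continuous_intros\<close>)
  have "eventually (\<lambda>x. N x > 0) at_top"
    unfolding N_def sinh_field_def cosh_field_def by real_asymp
  from eventually_happens'[OF trivial_limit_at_top_linorder eventually_conj[OF this eventually_gt_at_top[of 0]]]
  obtain x2 where x2: "x2 > 0" "N x2 > 0" by blast
  show ?thesis
  proof (rule sign_change[of N, OF _ _ b(1) _ _ _ x2])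
    show "(N has_real_derivative 2 * sinh x * (sinh x - real m * x)) (at x)" for x
      unfolding N_def by (rule radius_numerator_derivative)
    show "continuous_on {0..} N" unfolding N_def by (intro continuous_intros)
    show "2 * sinh x * (sinh x - real m * x) < 0" if "0 < x" "x < b" for x
      using b(2)[OF that] that by (intro mult_pos_neg) auto
    show "2 * sinh x * (sinh x - real m * x) > 0" if "b < x" for x
      using b(3)[OF that] that b(1) by (intro mult_pos_pos) auto
  qed (use that in \<open>auto simp: N_def\<close>)
qed

theorem theorem8:
  fixes m :: nat
  assumes "m \<ge> 1"
  shows
    "(m = 1 \<longrightarrow> strict_mono_on {0<..} (\<lambda>R. steklov2_eta m R * R)) \<and>
     (m \<ge> 2 \<longrightarrow> (\<exists>R\<^sub>m>0.
        strict_antimono_on {0<..<R\<^sub>m} (\<lambda>R. steklov2_eta m R * R) \<and>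
        strict_mono_on {R\<^sub>m<..} (\<lambda>R. steklov2_eta m R * R))) \<and>
     strict_mono_on {0<..} (\<lambda>R. steklov2_eta m R * sinh R) \<and>
     strict_antimono_on {0<..} (\<lambda>R. steklov2_eta m R * tanh (R / 2)) \<and>
     (m \<le> 2 \<longrightarrow> strict_mono_on {0<..} (\<lambda>R. steklov2_eta m R * sinh (R / 2))) \<and>
     (m \<ge> 3 \<longrightarrow> (\<exists>R\<^sub>m>0.
        strict_antimono_on {0<..<R\<^sub>m} (\<lambda>R. steklov2_eta m R * sinh (R / 2)) \<and>
        strict_mono_on {R\<^sub>m<..} (\<lambda>R. steklov2_eta m R * sinh (R / 2))))"
proof -
  have mono: "monotone_on {0<..} (<) r (\<lambda>R. eta m R * w R) \<Longrightarrow>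
      monotone_on {0<..} (<) r (\<lambda>R. steklov2_eta m R * w R)"
    for r :: "real \<Rightarrow> real \<Rightarrow> bool" and w
    by (simp add: monotone_on_def steklov2_eta_eq)
  have valley: "\<exists>b>0. strict_antimono_on {0<..<b} (\<lambda>R. steklov2_eta m R * w R) \<and>
      strict_mono_on {b<..} (\<lambda>R. steklov2_eta m R * w R)"
    if "\<exists>b>0. strict_antimono_on {0<..<b} (\<lambda>R. eta m R * w R) \<and>
      strict_mono_on {b<..} (\<lambda>R. eta m R * w R)" for w
  proof -
    obtain b where "b > 0" "strict_antimono_on {0<..<b} (\<lambda>R. eta m R * w R)"
      "strict_mono_on {b<..} (\<lambda>R. eta m R * w R)" using \<open>\<exists>b>0. _ b\<close> by blast
    then show ?thesis
      by (intro exI[of _ b]) (simp add: monotone_on_def steklov2_eta_eq)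
  qed
  interpret sinh: monotone_quotient m "\<lambda>x. tanh (x / 2) ^ (2 * m) * sinh x * sinh x"
    "\<lambda>x. 2 * cosh x + 2 * real m" "\<lambda>x. 2 * sinh x"
    by (rule sinh_quotient)
  interpret tanh: monotone_quotient m "\<lambda>x. tanh (x / 2) ^ (2 * m) * sinh x * tanh (x / 2)"
    "\<lambda>x. 1 + 2 * real m / (1 + cosh x)" "\<lambda>x. - (2 * real m * sinh x) / (1 + cosh x)\<^sup>2"
    by (rule tanh_half_quotient)
  interpret half: monotone_quotient m "\<lambda>x. tanh (x / 2) ^ (2 * m) * sinh x * sinh (x / 2)"
    "\<lambda>x. 3 / 2 * cosh (x / 2) + (2 * real m - 1) / (2 * cosh (x / 2))"
    "\<lambda>x. sinh (x / 2) * (3 * (cosh (x / 2))\<^sup>2 - (2 * real m - 1)) / (4 * (cosh (x / 2))\<^sup>2)"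
    by (rule sinh_half_quotient)
  interpret radius: monotone_quotient m "\<lambda>x. tanh (x / 2) ^ (2 * m) * sinh x * x"
    "\<lambda>x. 1 + (cosh x + 2 * real m) / shc (x\<^sup>2)"
    "\<lambda>x. (sinh x * cosh x - x + 2 * real m * (sinh x - x * cosh x)) / (sinh x)\<^sup>2"
    by (rule radius_quotient)
  let ?N = "\<lambda>x. sinh x * cosh x - x + 2 * real m * (sinh x - x * cosh x)"
  have "strict_mono_on {0<..} (\<lambda>R. eta m R * R)" if m: "m = 1"
  proof (rule radius.quotient_strict_mono[unfolded eta_times])
    fix x :: real assume x: "x > 0"
    have "?N 0 < ?N x"
    proof (rule DERIV_pos_imp_increasing_open[OF x])
      fix z :: real assume z: "0 < z"
      have "2 * sinh z * (sinh z - real m * z) > 0"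
        using z sinh_greater[OF z] m by simp
      then show "\<exists>D. (?N has_real_derivative D) (at z) \<and> 0 < D"
        using radius_numerator_derivative by blast
    qed (intro continuous_intros)
    then show "?N x / (sinh x)\<^sup>2 > 0" using x by simp
  qed
  moreover have "\<exists>b>0. strict_antimono_on {0<..<b} (\<lambda>R. eta m R * R) \<and>
      strict_mono_on {b<..} (\<lambda>R. eta m R * R)" if m: "m \<ge> 2"
  proof -
    obtain b where b: "b > 0" "\<And>x. 0 < x \<Longrightarrow> x < b \<Longrightarrow> ?N x < 0" "\<And>x. b < x \<Longrightarrow> ?N x > 0"
      using radius_numerator_sign[OF m] by blast
    show ?thesis
    proof (rule radius.quotient_valley[unfolded eta_times])
      show "?N x / (sinh x)\<^sup>2 < 0" if "0 < x" "x < b" for x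
        using b(2)[OF that] that by (simp add: divide_neg_pos)
      show "?N x / (sinh x)\<^sup>2 > 0" if "b < x" for x
        using b(3)[OF that] that b(1) by simp
      show "\<exists>x\<ge>1. B < eta m x * x" for B
        using eta_times_unbounded[of "\<lambda>x. x" B m] by (simp only: eta_times)
    qed fact
  qed
  moreover have "strict_mono_on {0<..} (\<lambda>R. eta m R * sinh R)"
    using sinh.quotient_strict_mono unfolding eta_times by simp
  moreover have "strict_antimono_on {0<..} (\<lambda>R. eta m R * tanh (R / 2))"
  proof (rule tanh.quotient_strict_antimono[unfolded eta_times])
    fix x :: real assume x: "x > 0"
    then have "2 * real m * sinh x > 0" "1 + cosh x > 0"
      using assms cosh_real_pos[of x] by (simp, linarith)
    then show "- (2 * real m * sinh x) / (1 + cosh x)\<^sup>2 < 0"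
      by (intro divide_neg_pos) auto
  qed
  moreover have "strict_mono_on {0<..} (\<lambda>R. eta m R * sinh (R / 2))" if m: "m \<le> 2"
  proof (rule half.quotient_strict_mono[unfolded eta_times])
    fix x :: real assume x: "x > 0"
    then have "cosh (x / 2) > 1" using cosh_real_strict_mono[of 0 "x / 2"] by simp
    then have "(cosh (x / 2))\<^sup>2 > 1" by simp
    \<comment> \<open>For m at most 2 the constant 2 m - 1 is at most 3; m = 2 is the borderline
      case, saved by the strict inequality cosh > 1.\<close>
    then have "3 * (cosh (x / 2))\<^sup>2 - (2 * real m - 1) > 0" using m by simp
    then show "sinh (x / 2) * (3 * (cosh (x / 2))\<^sup>2 - (2 * real m - 1)) / (4 * (cosh (x / 2))\<^sup>2) > 0"
      using x cosh_real_nonzero by simp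
  qed
  moreover have "\<exists>b>0. strict_antimono_on {0<..<b} (\<lambda>R. eta m R * sinh (R / 2)) \<and>
      strict_mono_on {b<..} (\<lambda>R. eta m R * sinh (R / 2))" if m: "m \<ge> 3"
  proof -
    \<comment> \<open>The value of cosh (x/2) at which \<open>\<rho>'\<close> vanishes; it exceeds 1
      because 2 m - 1 > 3. As the argument is x/2, the threshold for x is
      \<open>2 * a\<close>.\<close>
    define v where "v = sqrt ((2 * real m - 1) / 3)"
    have v: "v > 1" "v\<^sup>2 = (2 * real m - 1) / 3" using m by (simp_all add: v_def)
    obtain a where a: "a > 0" "\<And>x. 0 < x \<Longrightarrow> x < a \<Longrightarrow> cosh x < v" "\<And>x. a < x \<Longrightarrow> v < cosh x"
      using cosh_threshold[OF v(1)] by blast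
    show ?thesis
    proof (rule half.quotient_valley[unfolded eta_times])
      show "2 * a > 0" using a(1) by simp
      show "sinh (x / 2) * (3 * (cosh (x / 2))\<^sup>2 - (2 * real m - 1)) / (4 * (cosh (x / 2))\<^sup>2) < 0"
        if "0 < x" "x < 2 * a" for x
      proof -
        have "(cosh (x / 2))\<^sup>2 < v\<^sup>2"
          using a(2)[of "x / 2"] that by (intro power_strict_mono) auto
        then have "3 * (cosh (x / 2))\<^sup>2 - (2 * real m - 1) < 0" unfolding v(2) by simp
        then show ?thesis
          using that cosh_real_nonzero by (intro divide_neg_pos mult_pos_neg) auto
      qed
      show "sinh (x / 2) * (3 * (cosh (x / 2))\<^sup>2 - (2 * real m - 1)) / (4 * (cosh (x / 2))\<^sup>2) > 0"
        if "2 * a < x" for x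
      proof -
        have "v\<^sup>2 < (cosh (x / 2))\<^sup>2"
          using a(3)[of "x / 2"] that v(1) by (intro power_strict_mono) auto
        then have "3 * (cosh (x / 2))\<^sup>2 - (2 * real m - 1) > 0" unfolding v(2) by simp
        then show ?thesis
          using that a(1) cosh_real_nonzero by (intro divide_pos_pos mult_pos_pos) auto
      qed
      show "\<exists>x\<ge>1. B < eta m x * sinh (x / 2)" for B
      proof (rule eta_times_unbounded[unfolded eta_times])
        show "x / 2 \<le> sinh (x / 2)" if "x > 0" for x :: real
          using sinh_greater[of "x / 2"] that by simp
      qed
    qed
  qed
  ultimately show ?thesis
    using mono valley[of "\<lambda>R. R"] valley[of "\<lambda>R. sinh (R / 2)"] by auto
qed

end
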